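(* Let $(\vec U^h,P^h,\vec X^h,\kappa^h)$ be a solution of the semidiscrete continuous-in-time scheme (a)--(d) on $(0,T]$. Then for $t\in(0,T]$ $$\gamma\,\frac{\rm d}{{\rm d}t}\,\mathcal H^{d-1}(\Gamma^h(t))+2\,\big\|[\mu^h]^{\frac12}\,\underline{\underline D}(\vec U^h)\big\|_{0}^2=\left(\vec f^h,\vec U^h\right).$$
   Context: $d\in\{2,3\}$, $\Omega\subset\mathbb R^d$ is a bounded polyhedral domain, $T>0$. $(\cdot,\cdot)$ and $\|\cdot\|_0$ are the $L^2$ inner product and norm on $\Omega$; $\underline{\underline D}(\vec u)=\frac12(\nabla\vec u+(\nabla\vec u)^T)$. For $t\in[0,T]$, $\mathcal T^h(t)$ is a regular partitioning of $\Omega$ into disjoint open simplices, $\mathbb U^h(t)\subset H^1_0(\Omega,\mathbb R^d)$ and $\mathbb P^h(t)\subset L^2(\Omega)$ are (finite-dimensional, $\mathbb U^h(t)$ continuous) finite element spaces on it, and $\widehat{\mathbb P}^h(t)=\{\varphi\in\mathbb P^h(t):\int_\Omega\varphi=0\}$. $\Gamma^h(t)\subset\overline\Omega$, $t\in[0,T]$, is an evolving closed polyhedral surface without self-intersections, i.e. a union of closures of disjoint open non-degenerate $(d-1)$-simplices $\sigma_j(t)$ without hanging vertices, with fixed connectivity and vertices $\vec q_k(t)$ depending differentiably on $t$. $\Omega^h_-(t)$ and $\Omega^h_+(t)$ are its interior and its exterior in $\Omega$, and $\vec\nu^h$ is the piecewise constant unit normal pointing into $\Omega^h_+(t)$. $W(\Gamma^h(t))$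 is the space of continuous scalar functions on $\Gamma^h(t)$ that are affine on each $\sigma_j(t)$, and $\underline V(\Gamma^h(t))=[W(\Gamma^h(t))]^d$. $\vec X^h(t)\in\underline V(\Gamma^h(t))$ is the identity function on $\Gamma^h(t)$, and $\vec X^h_t\in\underline V(\Gamma^h(t))$ is the velocity with nodal values $\frac{\rm d}{{\rm d}t}\vec q_k(t)$ at $\vec q_k(t)$. $\nabla_s$ is the surface gradient on $\Gamma^h(t)$; $\langle v,w\rangle_{\Gamma^h(t)}=\int_{\Gamma^h(t)}v\cdot w\,d\mathcal H^{d-1}$; and $\langle v,w\rangle^h_{\Gamma^h(t)}=\frac1d\sum_j\mathcal H^{d-1}(\sigma_j(t))\sum_{\vec q\text{ vertex of }\sigma_j(t)}(v\cdot w)(\vec q^-)$, where $\vec q^-$ denotes the limit from within $\sigma_j(t)$. $\gamma>0$, $\mu_\pm>0$; $\mu^h(t)$ is piecewise constant on $\mathcal T^h(t)$, equal to $\mu_-$ on elements contained in $\Omega^h_-(t)$, $\mu_+$ on elements contained in $\Omega^h_+(t)$, $\frac12(\mu_-+\mu_+)$ on elements intersecting $\Gamma^h(t)$. $\vec f^h$ is the continuous piecewise quadratic nodal interpolant of the forcing $\vec f(t)$. Semidiscrete scheme: given $\Gamma^h(0)$, for $t\in(0,T]$ find $\vec U^h(t)\in\mathbb U^h(t)$, $P^h(t)\in\widehat{\mathbb P}^h(t)$, $\vec X^h(t)\in\underline V(\Gamma^h(t))$, $\kappa^h(t)\in W(\Gamma^h(t))$ with (a) $2(\mu^h\underline{\underline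 D}(\vec U^h),\underline{\underline D}(\vec\xi))-(P^h,\nabla\cdot\vec\xi)-\gamma\langle\kappa^h\vec\nu^h,\vec\xi\rangle_{\Gamma^h(t)}=(\vec f^h,\vec\xi)$ for all $\vec\xi\in\mathbb U^h(t)$; (b) $(\nabla\cdot\vec U^h,\varphi)=0$ for all $\varphi\in\widehat{\mathbb P}^h(t)$; (c) $\langle\vec X^h_t,\chi\vec\nu^h\rangle^h_{\Gamma^h(t)}-\langle\vec U^h,\chi\vec\nu^h\rangle_{\Gamma^h(t)}=0$ for all $\chi\in W(\Gamma^h(t))$; (d) $\langle\kappa^h\vec\nu^h,\vec\eta\rangle^h_{\Gamma^h(t)}+\langle\nabla_s\vec X^h,\nabla_s\vec\eta\rangle_{\Gamma^h(t)}=0$ for all $\vec\eta\in\underline V(\Gamma^h(t))$. *)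

theory Defs
  imports "HOL-Analysis.Analysis"
begin

section \<open>Hausdorff measure\<close>

definition hausdorff_content :: "nat \<Rightarrow> real \<Rightarrow> 'a::metric_space set \<Rightarrow> ennreal" where
  "hausdorff_content m \<delta> A =
     (INF C \<in> {C :: nat \<Rightarrow> 'a set. A \<subseteq> (\<Union>k. C k) \<and> (\<forall>k. bounded (C k) \<and> diameter (C k) \<le> \<delta>)}.
        \<Sum>k. if C k = {} then 0
            else ennreal (unit_ball_vol (real m) * (diameter (C k) / 2) ^ m))"

definition hausdorff_outer :: "nat \<Rightarrow> 'a::metric_space set \<Rightarrow> ennreal" where
  "hausdorff_outer m A = (SUP \<delta> \<in> {0<..}. hausdorff_content m \<delta> A)"

text \<open>The outer measure is restricted to its Caratheodory-measurable sets, which gives a complete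
  measure; functions on a surface may therefore be arbitrary on null sets such as edges.\<close>

definition hausdorff_measure :: "nat \<Rightarrow> 'a::metric_space measure" where
  "hausdorff_measure m =
     measure_of UNIV (lambda_system UNIV UNIV (hausdorff_outer m)) (hausdorff_outer m)"

section \<open>Function spaces on the bulk domain\<close>

definition polyhedral_domain :: "(real^'n) set \<Rightarrow> bool" where
  "polyhedral_domain \<Omega> \<longleftrightarrow> open \<Omega> \<and> connected \<Omega> \<and> bounded \<Omega> \<and> \<Omega> \<noteq> {} \<and>
     (\<exists>\<F>. finite \<F> \<and> (\<forall>F\<in>\<F>. polytope F \<and> aff_dim F = int CARD('n) - 1) \<and> frontier \<Omega> = \<Union>\<F>)"

definition L2_space :: "(real^'n) set \<Rightarrow> (real^'n \<Rightarrow> 'b::euclidean_space) set" where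
  "L2_space \<Omega> = {u. u \<in> borel_measurable (lebesgue_on \<Omega>) \<and>
                    integrable (lebesgue_on \<Omega>) (\<lambda>x. (norm (u x))\<^sup>2)}"

definition L2_inner ::
  "(real^'n) set \<Rightarrow> (real^'n \<Rightarrow> 'b::euclidean_space) \<Rightarrow> (real^'n \<Rightarrow> 'b) \<Rightarrow> real" where
  "L2_inner \<Omega> u v = (\<integral>x. u x \<bullet> v x \<partial>lebesgue_on \<Omega>)"

definition L2_nrm :: "(real^'n) set \<Rightarrow> (real^'n \<Rightarrow> 'b::euclidean_space) \<Rightarrow> real" where
  "L2_nrm \<Omega> u = sqrt (\<integral>x. (norm (u x))\<^sup>2 \<partial>lebesgue_on \<Omega>)"

text \<open>\<open>D is\<close> is the iterated partial derivative along the coordinate directions in \<open>is\<close>.\<close>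

definition smooth_fun :: "(real^'n \<Rightarrow> 'b::real_normed_vector) \<Rightarrow> bool" where
  "smooth_fun \<phi> \<longleftrightarrow> (\<exists>D :: 'n list \<Rightarrow> real^'n \<Rightarrow> 'b. D [] = \<phi> \<and> (\<forall>is. continuous_on UNIV (D is)) \<and>
     (\<forall>is i x. ((\<lambda>s. D is (x + s *\<^sub>R axis i 1)) has_vector_derivative D (i # is) x) (at 0)))"

definition test_functions :: "(real^'n) set \<Rightarrow> (real^'n \<Rightarrow> 'b::real_normed_vector) set" where
  "test_functions \<Omega> = {\<phi>. smooth_fun \<phi> \<and> compact (closure {x. \<phi> x \<noteq> 0}) \<and> closure {x. \<phi> x \<noteq> 0} \<subseteq> \<Omega>}"

text \<open>\<open>G x $ i $ j\<close> is the weak derivative of the \<open>i\<close>-th component in direction \<open>j\<close>.\<close>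

definition has_weak_gradient ::
  "(real^'n) set \<Rightarrow> (real^'n \<Rightarrow> real^'n) \<Rightarrow> (real^'n \<Rightarrow> real^'n^'n) \<Rightarrow> bool" where
  "has_weak_gradient \<Omega> u G \<longleftrightarrow> G \<in> L2_space \<Omega> \<and>
     (\<forall>\<phi> \<in> test_functions \<Omega>. \<forall>i j.
        (\<integral>x. u x $ i * frechet_derivative \<phi> (at x) (axis j 1) \<partial>lebesgue_on \<Omega>) =
        - (\<integral>x. G x $ i $ j * \<phi> x \<partial>lebesgue_on \<Omega>))"

definition H1_space :: "(real^'n) set \<Rightarrow> (real^'n \<Rightarrow> real^'n) set" where
  "H1_space \<Omega> = {u \<in> L2_space \<Omega>. \<exists>G. has_weak_gradient \<Omega> u G}"

text \<open>Unique up to a null set.\<close>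

definition weak_grad :: "(real^'n) set \<Rightarrow> (real^'n \<Rightarrow> real^'n) \<Rightarrow> real^'n \<Rightarrow> real^'n^'n" where
  "weak_grad \<Omega> u = (SOME G. has_weak_gradient \<Omega> u G)"

definition H10_space :: "(real^'n) set \<Rightarrow> (real^'n \<Rightarrow> real^'n) set" where
  "H10_space \<Omega> = {u \<in> H1_space \<Omega>. \<exists>\<phi> :: nat \<Rightarrow> real^'n \<Rightarrow> real^'n.
     (\<forall>k. \<phi> k \<in> test_functions \<Omega>) \<and>
     (\<lambda>k. L2_nrm \<Omega> (\<lambda>x. \<phi> k x - u x)) \<longlonglongrightarrow> 0 \<and>
     (\<lambda>k. L2_nrm \<Omega> (\<lambda>x. jacobian (\<phi> k) (at x) - weak_grad \<Omega> u x)) \<longlonglongrightarrow> 0}"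

definition strain :: "(real^'n) set \<Rightarrow> (real^'n \<Rightarrow> real^'n) \<Rightarrow> real^'n \<Rightarrow> real^'n^'n" where
  "strain \<Omega> u x = (1/2) *\<^sub>R (weak_grad \<Omega> u x + transpose (weak_grad \<Omega> u x))"

definition weak_div :: "(real^'n) set \<Rightarrow> (real^'n \<Rightarrow> real^'n) \<Rightarrow> real^'n \<Rightarrow> real" where
  "weak_div \<Omega> u x = trace (weak_grad \<Omega> u x)"

section \<open>Bulk meshes and finite element spaces\<close>

definition simplex_vertices :: "(real^'n) set \<Rightarrow> (real^'n) set" where
  "simplex_vertices \<sigma> = {v. v extreme_point_of closure \<sigma>}"

definition regular_partitioning :: "(real^'n) set \<Rightarrow> (real^'n) set set \<Rightarrow> bool" where
  "regular_partitioning \<Omega> \<T> \<longleftrightarrow> finite \<T> \<and>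
     (\<forall>\<sigma>\<in>\<T>. \<exists>K. int CARD('n) simplex K \<and> \<sigma> = interior K) \<and>
     disjoint \<T> \<and> triangulation (closure ` \<T>) \<and>
     \<Union>\<T> \<subseteq> \<Omega> \<and> \<Union>(closure ` \<T>) = closure \<Omega>"

definition finite_dim_function_space :: "('a \<Rightarrow> 'b::real_vector) set \<Rightarrow> bool" where
  "finite_dim_function_space V \<longleftrightarrow>
     (\<exists>B. finite B \<and> V = range (\<lambda>(c :: ('a \<Rightarrow> 'b) \<Rightarrow> real) x. \<Sum>b\<in>B. c b *\<^sub>R b x))"

definition finite_element_space ::
  "(real^'n) set set \<Rightarrow> (real^'n \<Rightarrow> 'b::euclidean_space) set \<Rightarrow> bool" where
  "finite_element_space \<T> V \<longleftrightarrow> finite_dim_function_space V \<and>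
     (\<forall>u\<in>V. \<forall>\<sigma>\<in>\<T>. \<exists>p. polynomial_function p \<and> (\<forall>x\<in>\<sigma>. u x = p x))"

definition velocity_space ::
  "(real^'n) set \<Rightarrow> (real^'n) set set \<Rightarrow> (real^'n \<Rightarrow> real^'n) set \<Rightarrow> bool" where
  "velocity_space \<Omega> \<T> V \<longleftrightarrow> finite_element_space \<T> V \<and> V \<subseteq> H10_space \<Omega> \<and>
     (\<forall>u\<in>V. continuous_on (closure \<Omega>) u)"

definition pressure_space ::
  "(real^'n) set \<Rightarrow> (real^'n) set set \<Rightarrow> (real^'n \<Rightarrow> real) set \<Rightarrow> bool" where
  "pressure_space \<Omega> \<T> V \<longleftrightarrow> finite_element_space \<T> V \<and> V \<subseteq> L2_space \<Omega>"

definition mean_zero :: "(real^'n) set \<Rightarrow> (real^'n \<Rightarrow> real) set \<Rightarrow> (real^'n \<Rightarrow> real) set" where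
  "mean_zero \<Omega> V = {\<phi> \<in> V. (\<integral>x. \<phi> x \<partial>lebesgue_on \<Omega>) = 0}"

definition quadratic_map :: "('a::real_vector \<Rightarrow> 'b::real_vector) \<Rightarrow> bool" where
  "quadratic_map p \<longleftrightarrow> (\<exists>c l b. linear l \<and> bilinear b \<and> p = (\<lambda>x. c + l x + b x x))"

text \<open>The interpolation nodes are the vertices (\<open>v = w\<close>) and the edge midpoints.\<close>

definition quadratic_interpolant ::
  "(real^'n) set \<Rightarrow> (real^'n) set set \<Rightarrow> (real^'n \<Rightarrow> real^'n) \<Rightarrow> (real^'n \<Rightarrow> real^'n) \<Rightarrow> bool" where
  "quadratic_interpolant \<Omega> \<T> f fh \<longleftrightarrow> continuous_on (closure \<Omega>) fh \<and>
     (\<forall>\<sigma>\<in>\<T>. (\<exists>p. quadratic_map p \<and> (\<forall>x\<in>closure \<sigma>. fh x = p x)) \<and>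
       (\<forall>v\<in>simplex_vertices \<sigma>. \<forall>w\<in>simplex_vertices \<sigma>. fh (midpoint v w) = f (midpoint v w)))"

section \<open>Polyhedral surfaces\<close>

text \<open>A surface is given by the set \<open>S\<close> of its disjoint open \<open>(d-1)\<close>-simplices.\<close>

definition surface :: "(real^'n) set set \<Rightarrow> (real^'n) set" where
  "surface S = \<Union>(closure ` S)"

text \<open>The last clause says that the surface is a topological manifold of dimension \<open>d-1\<close> without
  boundary; in particular it excludes surfaces that touch themselves at a vertex.\<close>

definition closed_polyhedral_surface :: "(real^'n) set set \<Rightarrow> bool" where
  "closed_polyhedral_surface S \<longleftrightarrow> finite S \<and> S \<noteq> {} \<and>
     (\<forall>\<sigma>\<in>S. \<exists>K. (int CARD('n) - 1) simplex K \<and> \<sigma> = rel_interior K) \<and>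
     disjoint S \<and> triangulation (closure ` S) \<and>
     (\<forall>x\<in>surface S. \<exists>U V :: (real^'n) set. openin (top_of_set (surface S)) U \<and> x \<in> U \<and>
        subspace V \<and> dim V = CARD('n) - 1 \<and> U homeomorphic V)"

text \<open>\<open>C\<close> is the connectivity: the simplices are spanned by the vertices \<open>q k t\<close> with \<open>k \<in> J\<close>,
  for each \<open>J \<in> C\<close>.\<close>

definition evolving_polyhedral_surface ::
  "real \<Rightarrow> nat set set \<Rightarrow> (nat \<Rightarrow> real \<Rightarrow> real^'n) \<Rightarrow> (real \<Rightarrow> (real^'n) set set) \<Rightarrow> bool" where
  "evolving_polyhedral_surface T C q S \<longleftrightarrow> finite C \<and>
     (\<forall>J\<in>C. finite J \<and> card J = CARD('n)) \<and>
     (\<forall>t\<in>{0..T}.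
        S t = (\<lambda>J. rel_interior (convex hull ((\<lambda>k. q k t) ` J))) ` C \<and>
        inj_on (\<lambda>k. q k t) (\<Union>C) \<and>
        (\<forall>J\<in>C. \<not> affine_dependent ((\<lambda>k. q k t) ` J)) \<and>
        closed_polyhedral_surface (S t) \<and>
        (\<forall>k\<in>\<Union>C. q k differentiable (at t within {0..T})))"

definition interior_phase :: "(real^'n) set \<Rightarrow> (real^'n) set set \<Rightarrow> (real^'n) set" where
  "interior_phase \<Omega> S = \<Omega> \<inter> inside (surface S)"

definition exterior_phase :: "(real^'n) set \<Rightarrow> (real^'n) set set \<Rightarrow> (real^'n) set" where
  "exterior_phase \<Omega> S = \<Omega> \<inter> outside (surface S)"

text \<open>Elements that lie in neither phase intersect the surface. The value on the mesh skeleton, a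
  null set, is immaterial.\<close>

definition bulk_viscosity ::
  "(real^'n) set \<Rightarrow> (real^'n) set set \<Rightarrow> (real^'n) set set \<Rightarrow> real \<Rightarrow> real \<Rightarrow> real^'n \<Rightarrow> real" where
  "bulk_viscosity \<Omega> \<T> S \<mu>m \<mu>p x =
     (if \<exists>\<sigma>\<in>\<T>. x \<in> \<sigma> \<and> \<sigma> \<subseteq> interior_phase \<Omega> S then \<mu>m
      else if \<exists>\<sigma>\<in>\<T>. x \<in> \<sigma> \<and> \<sigma> \<subseteq> exterior_phase \<Omega> S then \<mu>p
      else (\<mu>m + \<mu>p) / 2)"

definition tangent_space :: "(real^'n) set \<Rightarrow> (real^'n) set" where
  "tangent_space \<sigma> = span {x - y | x y. x \<in> \<sigma> \<and> y \<in> \<sigma>}"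

text \<open>At points of \<open>\<Omega>\<close>, pointing into \<open>outside (surface S)\<close> is the same as pointing into
  \<open>exterior_phase \<Omega> S\<close>; the former also makes sense for simplices contained in the boundary
  of \<open>\<Omega>\<close>.\<close>

definition outer_unit_normal :: "(real^'n) set set \<Rightarrow> (real^'n \<Rightarrow> real^'n) \<Rightarrow> bool" where
  "outer_unit_normal S \<nu> \<longleftrightarrow> (\<forall>\<sigma>\<in>S. \<exists>n. norm n = 1 \<and> (\<forall>v\<in>tangent_space \<sigma>. n \<bullet> v = 0) \<and>
     (\<forall>x\<in>\<sigma>. \<nu> x = n \<and> (\<forall>\<^sub>F s in at_right 0. x + s *\<^sub>R n \<in> outside (surface S))))"

definition W_space :: "(real^'n) set set \<Rightarrow> (real^'n \<Rightarrow> real) set" where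
  "W_space S = {w. continuous_on (surface S) w \<and> (\<forall>\<sigma>\<in>S. \<exists>a b. \<forall>x\<in>\<sigma>. w x = a + b \<bullet> x)}"

definition V_space :: "(real^'n) set set \<Rightarrow> (real^'n \<Rightarrow> real^'n) set" where
  "V_space S = {\<eta>. \<forall>i. (\<lambda>x. \<eta> x $ i) \<in> W_space S}"

definition surface_grad :: "(real^'n) set set \<Rightarrow> (real^'n \<Rightarrow> real) \<Rightarrow> real^'n \<Rightarrow> real^'n" where
  "surface_grad S g x = (THE v. \<exists>\<sigma>\<in>S. x \<in> \<sigma> \<and> v \<in> tangent_space \<sigma> \<and>
     (g has_derivative (\<lambda>h. v \<bullet> h)) (at x within \<sigma>))"

definition surface_grad_vec ::
  "(real^'n) set set \<Rightarrow> (real^'n \<Rightarrow> real^'n) \<Rightarrow> real^'n \<Rightarrow> real^'n^'n" where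
  "surface_grad_vec S \<eta> x = (\<chi> i. surface_grad S (\<lambda>y. \<eta> y $ i) x)"

definition surface_area :: "(real^'n) set \<Rightarrow> real" where
  "surface_area A = measure (hausdorff_measure (CARD('n) - 1)) A"

definition surface_inner ::
  "(real^'n) set set \<Rightarrow> (real^'n \<Rightarrow> 'b::euclidean_space) \<Rightarrow> (real^'n \<Rightarrow> 'b) \<Rightarrow> real" where
  "surface_inner S v w = (LINT x:surface S|hausdorff_measure (CARD('n) - 1). v x \<bullet> w x)"

definition lumped_inner ::
  "(real^'n) set set \<Rightarrow> (real^'n \<Rightarrow> 'b::euclidean_space) \<Rightarrow> (real^'n \<Rightarrow> 'b) \<Rightarrow> real" where
  "lumped_inner S v w = (1 / real CARD('n)) *
     (\<Sum>\<sigma>\<in>S. surface_area \<sigma> * (\<Sum>z\<in>simplex_vertices \<sigma>. Lim (at z within \<sigma>) (\<lambda>x. v x \<bullet> w x)))"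

end

(* Testing the momentum equation with U, the kinematic condition with kappa and the curvature
   equation with the velocity X_t reduces the energy law to the identity
   d/dt area = <grad_s X, grad_s X_t>, which holds simplex by simplex: both sides are the area times
   the sum of the products of the edge velocities with the basis dual to the edges.

   The area of a simplex is a Hausdorff measure, so its dependence on the vertices has to be
   derived. The Hausdorff measure is a metric outer measure, invariant under isometries, and finite on
   cubes; hence in full dimension it is a constant multiple of Lebesgue measure, and the area of a
   simplex is that constant times the square root of the Gram determinant of its edges. The constant
   enters both sides of the identity, so the isodiametric inequality is not needed. *)
theory Submission
  imports Defs
begin

subsection \<open>Hausdorff measure\<close>

text \<open>The contraction of the surface gradient of the identity with that of a field is the
  surface divergence of the field, because the gradient of the identity is the tangential
  projection. For a piecewise affine field it is constant on each open simplex. On the area side the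
  same number is half the logarithmic derivative of the Gram determinant of the edges, since the
  inverse Gram matrix produces the dual basis. Two points shape the measure theory. The constant
  relating Hausdorff and Lebesgue measure has to be fixed before the simplex, so that it does not
  vary with time and passes through the derivative. And the integrand is known only on the open
  simplices; on their edges the surface gradient is an unspecified value, so integrals are formed in
  a complete measure and the edges must be shown to be null. The restriction to d = 2, 3 leaves
  segments and triangles, for which isometric models on the line and in the plane can be written
  down.\<close>

definition hausdorff_cost :: "nat \<Rightarrow> 'a::metric_space set \<Rightarrow> ennreal" where
  "hausdorff_cost m A =
     (if A = {} then 0 else ennreal (unit_ball_vol (real m) * (diameter A / 2) ^ m))"

text \<open>Allows covers to be padded with empty sets. The case split matters for
  \<open>m = 0\<close>, where the formula would charge 1 for an empty set.\<close>

lemma hausdorff_cost_empty [simp]: "hausdorff_cost m {} = 0"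
  by (simp add: hausdorff_cost_def)

lemma hausdorff_cost_le:
  fixes A :: "'a::metric_space set"
  assumes "bounded A" "diameter A \<le> d"
  shows "hausdorff_cost m A \<le> ennreal (unit_ball_vol (real m) * (d / 2) ^ m)"
  using assms diameter_ge_0[OF assms(1)] unfolding hausdorff_cost_def
  by (auto intro!: ennreal_leI mult_left_mono power_mono divide_right_mono)

text \<open>Diameters are compared instead of sets, so that images and preimages under isometries
  are covered. The last hypothesis excludes a nonempty set against the empty one, for which the
  inequality fails if \<open>m = 0\<close>.\<close>

lemma hausdorff_cost_mono:
  assumes "bounded A" "diameter A \<le> diameter B" "A \<noteq> {} \<Longrightarrow> B \<noteq> {}"
  shows "hausdorff_cost m A \<le> hausdorff_cost m B"
  using hausdorff_cost_le[OF assms(1,2), of m] assms(3)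
  by (cases "A = {}") (auto simp: hausdorff_cost_def[of m B])

lemma hausdorff_content_le_suminf:
  assumes "A \<subseteq> (\<Union>k. C k)" "\<And>k. bounded (C k)" "\<And>k. diameter (C k) \<le> \<delta>"
  shows "hausdorff_content m \<delta> A \<le> (\<Sum>k. hausdorff_cost m (C k))"
  unfolding hausdorff_content_def hausdorff_cost_def
  using assms by (intro INF_lower) auto

lemma le_hausdorff_content:
  assumes "\<And>C. A \<subseteq> (\<Union>k. C k) \<Longrightarrow> (\<And>k. bounded (C k)) \<Longrightarrow> (\<And>k. diameter (C k) \<le> \<delta>) \<Longrightarrow>
             y \<le> (\<Sum>k::nat. hausdorff_cost m (C k))"
  shows "y \<le> hausdorff_content m \<delta> A"
  unfolding hausdorff_content_def hausdorff_cost_def[symmetric]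
  by (rule INF_greatest) (use assms in auto)

lemma hausdorff_content_close:
  assumes "hausdorff_content m \<delta> A < y"
  obtains C :: "nat \<Rightarrow> _" where "A \<subseteq> (\<Union>k. C k)" "\<And>k. bounded (C k)" "\<And>k. diameter (C k) \<le> \<delta>"
    "(\<Sum>k. hausdorff_cost m (C k)) < y"
proof -
  have "\<not> (\<forall>C. A \<subseteq> (\<Union>k. C k) \<longrightarrow> (\<forall>k. bounded (C k)) \<longrightarrow> (\<forall>k. diameter (C k) \<le> \<delta>) \<longrightarrow>
      y \<le> (\<Sum>k::nat. hausdorff_cost m (C k)))"
    using le_hausdorff_content[of A \<delta> y m] assms by (meson not_le)
  then show ?thesis
    using that by (auto simp: not_le)
qed

lemma hausdorff_content_mono:
  "A \<subseteq> B \<Longrightarrow> hausdorff_content m \<delta> A \<le> hausdorff_content m \<delta> B"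
  by (rule le_hausdorff_content, rule hausdorff_content_le_suminf) auto

lemma hausdorff_content_antimono:
  "\<delta> \<le> \<delta>' \<Longrightarrow> hausdorff_content m \<delta>' A \<le> hausdorff_content m \<delta> A"
  by (rule le_hausdorff_content, rule hausdorff_content_le_suminf) (auto intro: order_trans)

text \<open>Each \<open>A n\<close> gets a cover within \<open>e / 2^(n+1)\<close> of its infimum;
  the excesses add up to \<open>e\<close>, and \<open>prod_decode\<close> lists the double sequence
  of covers as one.\<close>

lemma hausdorff_content_UN_le:
  "hausdorff_content m \<delta> (\<Union>i. A i) \<le> (\<Sum>i::nat. hausdorff_content m \<delta> (A i))"
proof (rule ennreal_le_epsilon)
  let ?O = "hausdorff_content m \<delta>"
  fix e :: real assume e: "0 < e" and fin: "(\<Sum>n. ?O (A n)) < top"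
  then have *: "?O (A n) < ?O (A n) + e * (1/2)^Suc n" for n
    by (auto simp add: less_top dest!: ennreal_suminf_lessD)
  have "\<exists>B :: nat \<Rightarrow> _. A n \<subseteq> (\<Union>k. B k) \<and> (\<forall>k. bounded (B k)) \<and> (\<forall>k. diameter (B k) \<le> \<delta>) \<and>
      (\<Sum>k. hausdorff_cost m (B k)) < ?O (A n) + e * (1/2)^Suc n" for n
    using hausdorff_content_close[OF *] by metis
  then obtain B :: "nat \<Rightarrow> nat \<Rightarrow> _" where B: "\<And>n. A n \<subseteq> (\<Union>k. B n k)" "\<And>n k. bounded (B n k)"
      "\<And>n k. diameter (B n k) \<le> \<delta>"
      "\<And>n. (\<Sum>k. hausdorff_cost m (B n k)) < ?O (A n) + e * (1/2)^Suc n"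
    by metis
  define C where "C = case_prod B o prod_decode"
  have "(\<Union>i. A i) \<subseteq> (\<Union>i. C i)"
    using B(1) by (auto simp add: C_def subset_eq) (metis prod.case prod_encode_inverse)
  then have "?O (\<Union>i. A i) \<le> (\<Sum>i. hausdorff_cost m (C i))"
    using B(2,3) by (intro hausdorff_content_le_suminf) (auto simp: C_def split_def)
  also have "\<dots> = (\<Sum>n. \<Sum>i. hausdorff_cost m (B n i))"
    using suminf_ennreal_2dimen[of "\<lambda>n. \<Sum>i. hausdorff_cost m (B n i)"
        "\<lambda>x. hausdorff_cost m (case_prod B x)"]
    by (simp add: C_def comp_def)
  also have "\<dots> \<le> (\<Sum>n. ?O (A n) + e * (1/2) ^ Suc n)"
    by (intro suminf_le allI less_imp_le[OF B(4)]) auto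
  also have "... = (\<Sum>n. ?O (A n)) + (\<Sum>n. ennreal e * ennreal ((1/2) ^ Suc n))"
    using \<open>0 < e\<close> by (subst suminf_add[symmetric])
                     (auto simp del: ennreal_suminf_cmult simp add: ennreal_mult[symmetric])
  also have "\<dots> = (\<Sum>n. ?O (A n)) + e"
    unfolding ennreal_suminf_cmult
    by (subst suminf_ennreal_eq[OF zero_le_power power_half_series]) auto
  finally show "?O (\<Union>i. A i) \<le> (\<Sum>n. ?O (A n)) + e" .
qed

lemma hausdorff_content_le_outer: "\<delta> > 0 \<Longrightarrow> hausdorff_content m \<delta> A \<le> hausdorff_outer m A"
  unfolding hausdorff_outer_def by (auto intro: SUP_upper)

lemma hausdorff_outer_le:
  assumes "\<And>\<delta>. \<delta> > 0 \<Longrightarrow> hausdorff_content m \<delta> A \<le> y"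
  shows "hausdorff_outer m A \<le> y"
  unfolding hausdorff_outer_def by (rule SUP_least) (use assms in auto)

lemma hausdorff_outer_empty [simp]: "hausdorff_outer m {} = 0"
proof -
  have "hausdorff_content m \<delta> ({} :: 'a set) \<le> 0" if "\<delta> > 0" for \<delta>
    using hausdorff_content_le_suminf[of "{}" "\<lambda>_. {} :: 'a set" \<delta> m] that by simp
  then show ?thesis
    using hausdorff_outer_le[of m "{} :: 'a set" 0] by simp
qed

lemma hausdorff_outer_mono: "A \<subseteq> B \<Longrightarrow> hausdorff_outer m A \<le> hausdorff_outer m B"
  by (meson hausdorff_content_le_outer hausdorff_content_mono hausdorff_outer_le order_trans)

lemma hausdorff_outer_UN_le:
  "hausdorff_outer m (\<Union>i. A i) \<le> (\<Sum>i::nat. hausdorff_outer m (A i))"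
  by (rule hausdorff_outer_le, rule order_trans[OF hausdorff_content_UN_le])
    (auto intro!: suminf_le hausdorff_content_le_outer)

lemma outer_measure_space_hausdorff:
  "outer_measure_space UNIV (hausdorff_outer m :: 'a::metric_space set \<Rightarrow> ennreal)"
  by (auto simp: outer_measure_space_def positive_def increasing_def countably_subadditive_def
      intro: hausdorff_outer_mono hausdorff_outer_UN_le)

section \<open>Additivity on separated sets and measurability of closed sets\<close>

lemma hausdorff_outer_Un_le:
  "hausdorff_outer m (A \<union> B) \<le> hausdorff_outer m A + hausdorff_outer m B"
proof -
  have "hausdorff_outer m (\<Union>i. binaryset A B i) \<le> (\<Sum>i. hausdorff_outer m (binaryset A B i))"
    by (rule hausdorff_outer_UN_le)
  then show ?thesis
    by (simp add: UN_binaryset_eq suminf_binaryset_eq)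
qed

text \<open>A set of diameter less than \<open>e\<close> cannot meet both sets, so a fine cover splits in two.\<close>

lemma hausdorff_outer_Un_separated:
  assumes "e > 0" and sep: "\<And>x y. x \<in> A \<Longrightarrow> y \<in> B \<Longrightarrow> e \<le> dist x y"
  shows "hausdorff_outer m A + hausdorff_outer m B \<le> hausdorff_outer m (A \<union> B)"
proof -
  have *: "hausdorff_content m \<delta> A + hausdorff_content m \<delta> B \<le> hausdorff_content m \<delta> (A \<union> B)"
    if \<delta>: "0 < \<delta>" "\<delta> < e" for \<delta>
  proof (rule le_hausdorff_content)
    fix C :: "nat \<Rightarrow> 'a set"
    assume C: "A \<union> B \<subseteq> (\<Union>k. C k)" "\<And>k. bounded (C k)" "\<And>k. diameter (C k) \<le> \<delta>"
    define C1 where "C1 k = (if C k \<inter> A = {} then {} else C k)" for k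
    define C2 where "C2 k = (if C k \<inter> A = {} then C k else {})" for k
    have meets: "C k \<inter> B = {}" if ne: "C k \<inter> A \<noteq> {}" for k
    proof (rule ccontr)
      assume "C k \<inter> B \<noteq> {}"
      then obtain x y where xy: "x \<in> C k" "x \<in> A" "y \<in> C k" "y \<in> B" using ne by blast
      then have "dist x y \<le> diameter (C k)" using C(2) diameter_bounded_bound by blast
      with sep[OF xy(2,4)] C(3)[of k] \<delta> show False by linarith
    qed
    have "hausdorff_content m \<delta> A \<le> (\<Sum>k. hausdorff_cost m (C1 k))"
    proof (intro hausdorff_content_le_suminf)
      show "A \<subseteq> \<Union> (range C1)"
      proof
        fix x assume "x \<in> A"
        then obtain k where "x \<in> C k" using C(1) by blast
        then show "x \<in> \<Union> (range C1)" using \<open>x \<in> A\<close> by (auto simp: C1_def)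
      qed
    qed (use C \<delta> in \<open>auto simp: C1_def\<close>)
    moreover have "hausdorff_content m \<delta> B \<le> (\<Sum>k. hausdorff_cost m (C2 k))"
    proof (intro hausdorff_content_le_suminf)
      show "B \<subseteq> \<Union> (range C2)"
      proof
        fix x assume "x \<in> B"
        then obtain k where "x \<in> C k" using C(1) by blast
        then show "x \<in> \<Union> (range C2)" using meets[of k] \<open>x \<in> B\<close> by (auto simp: C2_def)
      qed
    qed (use C \<delta> in \<open>auto simp: C2_def\<close>)
    ultimately have "hausdorff_content m \<delta> A + hausdorff_content m \<delta> B
        \<le> (\<Sum>k. hausdorff_cost m (C1 k)) + (\<Sum>k. hausdorff_cost m (C2 k))"
      by (rule add_mono)
    also have "\<dots> = (\<Sum>k. hausdorff_cost m (C1 k) + hausdorff_cost m (C2 k))"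
      by (rule suminf_add) auto
    also have "\<dots> = (\<Sum>k. hausdorff_cost m (C k))"
      by (rule suminf_cong) (auto simp: C1_def C2_def)
    finally show "hausdorff_content m \<delta> A + hausdorff_content m \<delta> B \<le> (\<Sum>k. hausdorff_cost m (C k))" .
  qed
  \<comment> \<open>The two outer measures are suprema over independent scales. Contents grow as the
    scale shrinks, so a common scale below \<open>e\<close> dominates both.\<close>
  have "hausdorff_content m \<delta>1 A + hausdorff_content m \<delta>2 B \<le> hausdorff_outer m (A \<union> B)"
    if "0 < \<delta>1" "0 < \<delta>2" for \<delta>1 \<delta>2
  proof -
    define \<delta> where "\<delta> = min (e/2) (min \<delta>1 \<delta>2)"
    have \<delta>: "0 < \<delta>" "\<delta> < e" "\<delta> \<le> \<delta>1" "\<delta> \<le> \<delta>2" using that \<open>e > 0\<close> by (auto simp: \<delta>_def)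
    have "hausdorff_content m \<delta>1 A + hausdorff_content m \<delta>2 B
        \<le> hausdorff_content m \<delta> A + hausdorff_content m \<delta> B"
      by (intro add_mono hausdorff_content_antimono \<delta>)
    also have "\<dots> \<le> hausdorff_outer m (A \<union> B)"
      using *[OF \<delta>(1,2)] hausdorff_content_le_outer[OF \<delta>(1)] order_trans by blast
    finally show ?thesis .
  qed
  then show ?thesis
    unfolding hausdorff_outer_def[of m A] hausdorff_outer_def[of m B]
    by (auto intro!: SUP_least simp: ennreal_SUP_add_right ennreal_SUP_add_left[symmetric])
qed

text \<open>The distance \<open>e\<close> may depend on the pair. Among finitely many sets the
  minimum of these distances is still positive, so each new set is separated from the union of the
  earlier ones.\<close>

lemma hausdorff_outer_sum_separated:
  fixes R :: "nat \<Rightarrow> 'a::metric_space set"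
  assumes "\<And>i j. i < j \<Longrightarrow> \<exists>e>0. \<forall>x\<in>R i. \<forall>y\<in>R j. e \<le> dist x y"
  shows "(\<Sum>i<n. hausdorff_outer m (R i)) \<le> hausdorff_outer m (\<Union>i<n. R i)"
proof (induction n)
  case (Suc n)
  have "\<exists>e>0. \<forall>x\<in>(\<Union>i<k. R i). \<forall>y\<in>R n. e \<le> dist x y" if "k \<le> n" for k
    using that
  proof (induction k)
    case (Suc k)
    then obtain e1 where e1: "e1 > 0" "\<forall>x\<in>(\<Union>i<k. R i). \<forall>y\<in>R n. e1 \<le> dist x y" by auto
    obtain e2 where e2: "e2 > 0" "\<forall>x\<in>R k. \<forall>y\<in>R n. e2 \<le> dist x y"
      using assms[of k n] Suc by auto
    show ?case
      using e1 e2 by (intro exI[of _ "min e1 e2"]) (auto simp: less_Suc_eq min_le_iff_disj)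
  qed (auto intro: exI[of _ 1])
  then obtain e where e: "e > 0" "\<forall>x\<in>(\<Union>i<n. R i). \<forall>y\<in>R n. e \<le> dist x y"
    by blast
  have "(\<Sum>i<Suc n. hausdorff_outer m (R i)) \<le> hausdorff_outer m (\<Union>i<n. R i) + hausdorff_outer m (R n)"
    using Suc by (auto intro: add_right_mono)
  also have "\<dots> \<le> hausdorff_outer m ((\<Union>i<n. R i) \<union> R n)"
    using e by (intro hausdorff_outer_Un_separated[of e]) auto
  finally show ?case by (simp add: lessThan_Suc Un_commute)
qed simp

text \<open>Consecutive annuli may touch, so separation is available only from index difference 2
  on. The even and the odd annuli (\<open>c = 0\<close> and \<open>c = 1\<close>) are separated
  families inside \<open>A\<close>, hence the whole sum is at most twice the outer measure of
  \<open>A\<close>.\<close>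

lemma summable_separated_annuli:
  assumes "hausdorff_outer m A < top"
    and sep: "\<And>i j. i + 2 \<le> j \<Longrightarrow> \<exists>e>0. \<forall>x\<in>R i. \<forall>y\<in>R j. e \<le> dist x y"
    and sub: "\<And>i. R i \<subseteq> A"
  shows "(\<Sum>i. hausdorff_outer m (R i)) < top"
proof -
  let ?H = "hausdorff_outer m"
  have half: "(\<Sum>i<n. ?H (R (2 * i + c))) \<le> ?H A" for c n
  proof -
    have "(\<Sum>i<n. ?H (R (2 * i + c))) \<le> ?H (\<Union>i<n. R (2 * i + c))"
      by (rule hausdorff_outer_sum_separated, rule sep) auto
    also have "\<dots> \<le> ?H A"
      using sub by (intro hausdorff_outer_mono) auto
    finally show ?thesis .
  qed
  have "(\<Sum>i<n. ?H (R i)) \<le> ?H A + ?H A" for n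
  proof -
    have "(\<Sum>i<n. ?H (R i)) \<le> (\<Sum>i<2 * n. ?H (R i))"
      by (rule sum_mono2) auto
    also have "\<dots> = (\<Sum>i<n. ?H (R (2 * i))) + (\<Sum>i<n. ?H (R (2 * i + 1)))"
      by (induction n) (auto simp: algebra_simps)
    also have "\<dots> \<le> ?H A + ?H A"
      using half[of 0 n] half[of 1 n]
      by (intro add_mono) (simp_all only: add_0_right)
    finally show ?thesis .
  qed
  then have "(\<Sum>i. ?H (R i)) \<le> ?H A + ?H A"
    by (intro suminf_le_const) auto
  then show ?thesis
    using assms(1) by (simp add: le_less_trans less_top)
qed

text \<open>Caratheodory's criterion: \<open>A - S\<close> is exhausted by the parts of \<open>A\<close> at distance more than
  \<open>1/(n+1)\<close> from \<open>S\<close>, and the error is controlled by the convergent sum over the annuli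
  \<open>R k\<close>.\<close>

lemma closed_in_lambda_system_hausdorff:
  fixes S :: "'a::metric_space set"
  assumes "closed S"
  shows "S \<in> lambda_system UNIV UNIV (hausdorff_outer m)"
proof (cases "S = {}")
  case True
  then show ?thesis by (simp add: lambda_system_def)
next
  case False
  let ?H = "hausdorff_outer m :: 'a set \<Rightarrow> ennreal"
  have le: "?H (S \<inter> A) + ?H (A - S) \<le> ?H A" if fin: "?H A < top" for A
  proof -
    define R where "R k = {x\<in>A. 1 / (real k + 2) < infdist x S \<and> infdist x S \<le> 1 / (real k + 1)}" for k :: nat
    define B where "B n = {x\<in>A. 1 / (real n + 1) < infdist x S}" for n :: nat
    have cover: "A - S \<subseteq> B n \<union> (\<Union>k. R (k + n))" for n
    proof
      fix x assume x: "x \<in> A - S"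
      let ?d = "infdist x S"
      have pos: "?d > 0"
        using x \<open>closed S\<close> False by (metis DiffD2 in_closed_iff_infdist_zero infdist_nonneg less_eq_real_def)
      show "x \<in> B n \<union> (\<Union>k. R (k + n))"
      proof (cases "1 / (real n + 1) < ?d")
        case True then show ?thesis using x by (auto simp: B_def)
      next
        case le: False
        define P where "P k \<longleftrightarrow> 1 / (real k + 2) < ?d" for k :: nat
        obtain k0 where "1 / (real (Suc k0)) < ?d"
          using reals_Archimedean[OF pos] by (auto simp: inverse_eq_divide)
        moreover have "1 / (real k0 + 2) \<le> 1 / real (Suc k0)"
          by (intro divide_left_mono) auto
        ultimately have "P k0" unfolding P_def by linarith
        \<comment> \<open>Minimality gives the upper bound of the annulus \<open>R k\<close>. For
          \<open>k = 0\<close> there is no predecessor, and the bound 1 comes from \<open>x\<close>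
          lying outside \<open>B n\<close>, which also forces \<open>n \<le> k\<close>.\<close>
        define k where "k = (LEAST k. P k)"
        have Pk: "P k" unfolding k_def using \<open>P k0\<close> by (rule LeastI)
        have "n \<le> k"
        proof (rule ccontr)
          assume "\<not> n \<le> k"
          then have "1 / (real n + 1) \<le> 1 / (real k + 2)" by (intro divide_left_mono) auto
          then show False using Pk le unfolding P_def by linarith
        qed
        have "?d \<le> 1 / (real k + 1)"
        proof (cases k)
          case 0
          have "1 / (real n + 1) \<le> 1" by simp
          then have "?d \<le> 1" using le by linarith
          then show ?thesis using 0 by simp
        next
          case (Suc j)
          then have "\<not> P j" using not_less_Least[of j P] by (simp add: k_def)
          then show ?thesis using Suc by (simp add: P_def add.commute)
        qed
        then have "x \<in> R k" using Pk x by (simp add: R_def P_def)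
        then show ?thesis using \<open>n \<le> k\<close> by (metis UN_I UnCI le_add_diff_inverse2 UNIV_I)
      qed
    qed
    have sumR: "(\<Sum>k. ?H (R k)) < top"
    proof (rule summable_separated_annuli[OF fin])
      fix i j :: nat assume ij: "i + 2 \<le> j"
      \<comment> \<open>Points of \<open>R i\<close> have distance more than \<open>1/(i+2)\<close>
        from \<open>S\<close>, points of \<open>R j\<close> at most
        \<open>1/(j+1) \<le> 1/(i+3)\<close>; \<open>e\<close> is the gap.\<close>
      define e where "e = 1 / (real i + 2) - 1 / (real i + 3)"
      have "e > 0"
        unfolding e_def diff_gt_0_iff_gt by (intro divide_strict_left_mono) auto
      moreover have "e \<le> dist x y" if "x \<in> R i" "y \<in> R j" for x y
      proof -
        have "infdist x S \<le> infdist y S + dist x y" by (rule infdist_triangle)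
        moreover have "1 / (real j + 1) \<le> 1 / (real i + 3)" using ij by (intro divide_left_mono) auto
        ultimately show ?thesis using that by (simp add: R_def e_def)
      qed
      ultimately show "\<exists>e>0. \<forall>x\<in>R i. \<forall>y\<in>R j. e \<le> dist x y" by blast
    qed (auto simp: R_def)
    show ?thesis
    proof (rule ennreal_le_epsilon)
      fix e :: real assume "e > 0"
      define r where "r k = enn2real (?H (R k))" for k
      have Hr: "?H (R k) = ennreal (r k)" for k
        using sumR ennreal_suminf_lessD[of "\<lambda>k. ?H (R k)" top k] by (simp add: r_def)
      have sr: "summable r"
        by (rule summable_suminf_not_top) (use sumR in \<open>auto simp: Hr[symmetric], auto simp: r_def\<close>)
      \<comment> \<open>This \<open>n\<close> makes the annuli beyond \<open>B n\<close> contribute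
        less than \<open>e\<close>, so \<open>B n\<close> carries \<open>A - S\<close> up to
        \<open>e\<close>.\<close>
      obtain n where "norm (\<Sum>i. r (i + n)) < e"
        using suminf_exist_split[OF \<open>e > 0\<close> sr] by blast
      moreover have "(\<Sum>i. ?H (R (i + n))) = ennreal (\<Sum>i. r (i + n))"
        unfolding Hr by (rule suminf_ennreal2) (auto simp: r_def sr intro: summable_ignore_initial_segment[of r, unfolded r_def] sr[unfolded r_def])
      ultimately have tail: "(\<Sum>i. ?H (R (i + n))) \<le> ennreal e"
        by (auto intro: ennreal_leI)
      have "?H (A - S) \<le> ?H (B n) + ?H (\<Union>k. R (k + n))"
        using hausdorff_outer_mono[OF cover] hausdorff_outer_Un_le order_trans by blast
      also have "\<dots> \<le> ?H (B n) + ennreal e"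
        using hausdorff_outer_UN_le[of m "\<lambda>k. R (k + n)"] tail by (auto intro: add_left_mono order_trans)
      finally have "?H (S \<inter> A) + ?H (A - S) \<le> (?H (S \<inter> A) + ?H (B n)) + ennreal e"
        by (metis add.assoc add_left_mono)
      also have "?H (S \<inter> A) + ?H (B n) \<le> ?H ((S \<inter> A) \<union> B n)"
      proof (rule hausdorff_outer_Un_separated[of "1 / (real n + 1)"])
        fix x y assume "x \<in> S \<inter> A" "y \<in> B n"
        then show "1 / (real n + 1) \<le> dist x y"
          using infdist_le[of x S y] by (auto simp: B_def dist_commute)
      qed auto
      also have "\<dots> \<le> ?H A" by (rule hausdorff_outer_mono) (auto simp: B_def)
      finally show "?H (S \<inter> A) + ?H (A - S) \<le> ?H A + ennreal e"
        by (simp add: add_right_mono)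
    qed
  qed
  have "?H (S \<inter> A) + ?H (A - S) = ?H A" for A
  proof (rule antisym)
    show "?H (S \<inter> A) + ?H (A - S) \<le> ?H A"
      using le[of A] by (cases "?H A = top") (simp_all add: less_top)
    have "A = (S \<inter> A) \<union> (A - S)" by blast
    then show "?H A \<le> ?H (S \<inter> A) + ?H (A - S)" using hausdorff_outer_Un_le by metis
  qed
  moreover have "(UNIV - S) \<inter> A = A - S" for A by blast
  ultimately show ?thesis by (simp add: lambda_system_def)
qed

section \<open>The Hausdorff measure, its null sets and isometries\<close>

lemma measure_space_hausdorff:
  "measure_space UNIV (lambda_system UNIV UNIV (hausdorff_outer m)) (hausdorff_outer m)"
  using sigma_algebra.caratheodory_lemma[OF sigma_algebra_Pow[of UNIV, unfolded Pow_UNIV] outer_measure_space_hausdorff] .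

lemma space_hausdorff_measure [simp]: "space (hausdorff_measure m) = UNIV"
  by (simp add: hausdorff_measure_def space_measure_of_conv)

lemma sets_hausdorff_measure:
  "sets (hausdorff_measure m) = lambda_system UNIV UNIV (hausdorff_outer m :: 'a::metric_space set \<Rightarrow> ennreal)"
proof -
  interpret sigma_algebra UNIV "lambda_system UNIV UNIV (hausdorff_outer m :: 'a set \<Rightarrow> ennreal)"
    using measure_space_hausdorff[where 'a = 'a, of m] by (simp add: measure_space_def)
  show ?thesis
    by (simp add: hausdorff_measure_def sets_measure_of_conv sigma_sets_eq)
qed

lemma emeasure_hausdorff_measure:
  "A \<in> sets (hausdorff_measure m) \<Longrightarrow> emeasure (hausdorff_measure m) A = hausdorff_outer m A"
  using measure_space_hausdorff[of m] emeasure_measure_of_sigma[of UNIV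
      "lambda_system UNIV UNIV (hausdorff_outer m)" "hausdorff_outer m" A]
  unfolding sets_hausdorff_measure unfolding hausdorff_measure_def measure_space_def by blast

lemma borel_subset_hausdorff: "sets borel \<subseteq> sets (hausdorff_measure m :: 'a::metric_space measure)"
proof -
  have "Collect closed \<subseteq> sets (hausdorff_measure m :: 'a measure)"
    using closed_in_lambda_system_hausdorff by (auto simp: sets_hausdorff_measure)
  from sets.sigma_sets_subset[OF this] show ?thesis
    by (simp add: borel_eq_closed)
qed

lemma borel_in_sets_hausdorff [intro]: "A \<in> sets borel \<Longrightarrow> A \<in> sets (hausdorff_measure m)"
  using borel_subset_hausdorff by blast

text \<open>Completeness of the Caratheodory construction: monotonicity removes the part of a test
  set inside \<open>A\<close>, and subadditivity keeps the rest. This makes simplex boundaries and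
  all their subsets measurable.\<close>

lemma hausdorff_outer_0_null_sets:
  assumes "hausdorff_outer m A = 0"
  shows "A \<in> null_sets (hausdorff_measure m)"
proof -
  have "hausdorff_outer m (A \<inter> B) + hausdorff_outer m ((UNIV - A) \<inter> B) = hausdorff_outer m B" for B
  proof -
    have 0: "hausdorff_outer m (A \<inter> B) = 0"
      using hausdorff_outer_mono[of "A \<inter> B" A m] assms by simp
    have "hausdorff_outer m B \<le> hausdorff_outer m (A \<inter> B) + hausdorff_outer m ((UNIV - A) \<inter> B)"
      using hausdorff_outer_Un_le[of m "A \<inter> B" "(UNIV - A) \<inter> B"]
      by (simp add: Int_Un_distrib2[symmetric])
    moreover have "hausdorff_outer m ((UNIV - A) \<inter> B) \<le> hausdorff_outer m B"
      by (rule hausdorff_outer_mono) auto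
    ultimately show ?thesis using 0 by simp
  qed
  then have "A \<in> sets (hausdorff_measure m)" by (simp add: sets_hausdorff_measure lambda_system_def)
  then show ?thesis using assms by (simp add: null_sets_def emeasure_hausdorff_measure)
qed

text \<open>The hypothesis asks that every distance within \<open>D\<close> occurs within
  \<open>C\<close>. This treats images and preimages under an isometry alike.\<close>

lemma bounded_diameter_le:
  assumes "bounded C" and "\<And>x y. x \<in> D \<Longrightarrow> y \<in> D \<Longrightarrow> \<exists>u\<in>C. \<exists>v\<in>C. dist x y = dist u v"
  shows "bounded D \<and> diameter D \<le> diameter C"
proof -
  have "dist x y \<le> diameter C" if "x \<in> D" "y \<in> D" for x y
    using assms(2)[OF that] diameter_bounded_bound[OF assms(1)] by metis
  then show ?thesis
    using diameter_ge_0[OF assms(1)] unfolding bounded_two_points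
    by (cases "D = {}") (auto simp: diameter_def[of D] intro: cSUP_least)
qed

text \<open>Covers are pushed forward by images and pulled back by preimages, and neither increases
  diameters. Surjectivity is not assumed: the map will embed a space of lower dimension, and the
  parts of a covering set outside the range drop out of its preimage.\<close>

lemma hausdorff_outer_isometric_image:
  fixes f :: "'a::metric_space \<Rightarrow> 'b::metric_space"
  assumes iso: "\<And>x y. dist (f x) (f y) = dist x y"
  shows "hausdorff_outer m (f ` A) = hausdorff_outer m A"
proof -
  have img: "bounded (f ` C) \<and> diameter (f ` C) \<le> diameter C" if "bounded C" for C
    by (rule bounded_diameter_le[OF that]) (use iso in blast)
  have pre: "bounded (f -` C) \<and> diameter (f -` C) \<le> diameter C" if "bounded C" for C
    by (rule bounded_diameter_le[OF that]) (metis iso vimageE)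
  have "hausdorff_content m \<delta> (f ` A) = hausdorff_content m \<delta> A" for \<delta>
  proof (rule antisym; rule le_hausdorff_content)
    fix C :: "nat \<Rightarrow> 'a set"
    assume C: "A \<subseteq> (\<Union>k. C k)" "\<And>k. bounded (C k)" "\<And>k. diameter (C k) \<le> \<delta>"
    have "hausdorff_content m \<delta> (f ` A) \<le> (\<Sum>k. hausdorff_cost m (f ` C k))"
    proof (rule hausdorff_content_le_suminf)
      show "f ` A \<subseteq> (\<Union>k. f ` C k)" using C(1) by blast
    qed (use img C in \<open>meson order_trans\<close>)+
    also have "\<dots> \<le> (\<Sum>k. hausdorff_cost m (C k))"
      using img[OF C(2)] by (intro suminf_le hausdorff_cost_mono) auto
    finally show "hausdorff_content m \<delta> (f ` A) \<le> (\<Sum>k. hausdorff_cost m (C k))" .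
  next
    fix C :: "nat \<Rightarrow> 'b set"
    assume C: "f ` A \<subseteq> (\<Union>k. C k)" "\<And>k. bounded (C k)" "\<And>k. diameter (C k) \<le> \<delta>"
    have "hausdorff_content m \<delta> A \<le> (\<Sum>k. hausdorff_cost m (f -` C k))"
    proof (rule hausdorff_content_le_suminf)
      show "A \<subseteq> (\<Union>k. f -` C k)" using C(1) by blast
    qed (use pre C in \<open>meson order_trans\<close>)+
    also have "\<dots> \<le> (\<Sum>k. hausdorff_cost m (C k))"
      using pre[OF C(2)] by (intro suminf_le hausdorff_cost_mono) auto
    finally show "hausdorff_content m \<delta> A \<le> (\<Sum>k. hausdorff_cost m (C k))" .
  qed
  then show ?thesis by (simp add: hausdorff_outer_def)
qed

subsection \<open>Hausdorff measure of full dimension\<close>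

text \<open>The size \<open>d\<close> of the pieces is kept apart from the admissible scale
  \<open>\<delta>\<close>: the bound must retain \<open>d\<close>, so that its power can cancel the
  number of pieces.\<close>

lemma hausdorff_content_finite_cover:
  assumes "finite I" "A \<subseteq> (\<Union>i\<in>I. B i)" "0 \<le> \<delta>" "d \<le> \<delta>"
    and B: "\<And>i. i \<in> I \<Longrightarrow> bounded (B i)" "\<And>i. i \<in> I \<Longrightarrow> diameter (B i) \<le> d"
  shows "hausdorff_content m \<delta> A \<le> of_nat (card I) * ennreal (unit_ball_vol (real m) * (d / 2) ^ m)"
proof -
  obtain h where h: "bij_betw h {..<card I} I"
    using ex_bij_betw_nat_finite[OF \<open>finite I\<close>] by (auto simp: atLeast0LessThan)
  define C where "C k = (if k < card I then B (h k) else {})" for k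
  have hI: "h k \<in> I" if "k < card I" for k
    using h that by (auto simp: bij_betw_def)
  have "(\<Union>i\<in>I. B i) = (\<Union>k<card I. B (h k))"
    using h by (metis bij_betw_imp_surj_on image_image)
  also have "\<dots> \<subseteq> (\<Union>k. C k)"
    by (auto simp: C_def)
  finally have "hausdorff_content m \<delta> A \<le> (\<Sum>k. hausdorff_cost m (C k))"
    using assms hI by (intro hausdorff_content_le_suminf) (force simp: C_def)+
  also have "\<dots> = (\<Sum>k<card I. hausdorff_cost m (C k))"
    by (rule suminf_finite) (auto simp: C_def)
  also have "\<dots> \<le> (\<Sum>k<card I. ennreal (unit_ball_vol (real m) * (d / 2) ^ m))"
    using B hI by (intro sum_mono hausdorff_cost_le) (auto simp: C_def)
  finally show ?thesis by simp
qed

text \<open>The cube splits into \<open>(2 * N * L) ^ D\<close> cells of side \<open>1/N\<close>,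
  whose diameter is at most \<open>D/N\<close> by the l1 bound on the norm. The powers of
  \<open>N\<close> cancel, so the bound is the same for all scales.\<close>

lemma hausdorff_outer_cube_finite:
  "hausdorff_outer DIM('m) (box (- real L *\<^sub>R One) (real L *\<^sub>R One :: 'm::euclidean_space)) < top"
proof -
  define D where "D = DIM('m)"
  let ?A = "box (- real L *\<^sub>R One) (real L *\<^sub>R One :: 'm)"
  have "hausdorff_content D \<delta> ?A \<le> ennreal (unit_ball_vol (real D) * (real D * real L) ^ D)"
    if "\<delta> > 0" for \<delta>
  proof -
    obtain N0 :: nat where N0: "real D / \<delta> < real N0" using reals_Archimedean2 by blast
    define N where "N = Suc N0"
    have N: "N > 0" "real D / real N \<le> \<delta>"
      using N0 that by (auto simp: N_def field_simps)
    define I where "I = (PiE Basis (\<lambda>_. {..<2 * N * L}) :: ('m \<Rightarrow> nat) set)"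
    define B where "B f = cbox (\<Sum>b\<in>Basis. (real (f b) / N - L) *\<^sub>R b)
        (\<Sum>b\<in>Basis. ((real (f b) + 1) / N - L) *\<^sub>R b :: 'm)" for f
    have "hausdorff_content D \<delta> ?A
        \<le> of_nat (card I) * ennreal (unit_ball_vol (real D) * (real D / real N / 2) ^ D)"
    proof (rule hausdorff_content_finite_cover)
      show "finite I" by (auto simp: I_def intro: finite_PiE)
      show "?A \<subseteq> (\<Union>f\<in>I. B f)"
      proof
        fix x assume x: "x \<in> ?A"
        \<comment> \<open>The cell index of \<open>x\<close>. As the box is open,
          \<open>N * (x \<bullet> b + L)\<close> lies strictly between 0 and
          \<open>2 * N * L\<close>, so its floor is an admissible index.\<close>
        define f where "f = restrict (\<lambda>b. nat \<lfloor>real N * (x \<bullet> b + L)\<rfloor>) Basis"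
        have b: "0 < real N * (x \<bullet> b + L)" "real N * (x \<bullet> b + L) < 2 * N * L" if "b \<in> Basis" for b
        proof -
          have "- real L < x \<bullet> b" "x \<bullet> b < real L" using x that by (auto simp: mem_box)
          then have "0 < x \<bullet> b + real L" "x \<bullet> b + real L < 2 * real L" by linarith+
          then show "0 < real N * (x \<bullet> b + L)" "real N * (x \<bullet> b + L) < 2 * N * L"
            using N by (auto simp: mult.commute)
        qed
        have "nat \<lfloor>real N * (x \<bullet> b + L)\<rfloor> < 2 * N * L" if "b \<in> Basis" for b
          using b[OF that] by (simp add: nat_less_iff floor_less_iff)
        then have "f \<in> I" by (auto simp: I_def f_def)
        moreover have "x \<in> B f"
        proof -
          have "real (f b) / N - L \<le> x \<bullet> b \<and> x \<bullet> b \<le> (real (f b) + 1) / N - L" if "b \<in> Basis" for b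
          proof -
            have "real (f b) \<le> real N * (x \<bullet> b + L)" "real N * (x \<bullet> b + L) \<le> real (f b) + 1"
              using b[OF that] that by (auto simp: f_def)
            then show ?thesis using N by (simp add: field_simps)
          qed
          then show ?thesis by (simp add: B_def mem_box)
        qed
        ultimately show "x \<in> (\<Union>f\<in>I. B f)" by blast
      qed
      fix f :: "'m \<Rightarrow> nat"
      show "diameter (B f) \<le> real D / real N"
      proof (rule diameter_le)
        fix x y assume xy: "x \<in> B f" "y \<in> B f"
        have "norm (x - y) \<le> (\<Sum>b\<in>Basis. \<bar>(x - y) \<bullet> b\<bar>)" by (rule norm_le_l1)
        also have "\<dots> \<le> (\<Sum>b\<in>(Basis :: 'm set). 1 / real N)"
        proof (rule sum_mono)
          fix b :: 'm assume "b \<in> Basis"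
          then show "\<bar>(x - y) \<bullet> b\<bar> \<le> 1 / real N"
            using xy by (force simp: B_def mem_box inner_diff_left add_divide_distrib abs_le_iff)
        qed
        finally show "norm (x - y) \<le> real D / real N" by (simp add: D_def)
      qed auto
    qed (use N that in \<open>auto simp: B_def\<close>)
    also have "card I = (2 * N * L) ^ D"
      by (simp add: I_def D_def card_PiE)
    also have "of_nat ((2 * N * L) ^ D) * ennreal (unit_ball_vol (real D) * (real D / real N / 2) ^ D)
        = ennreal (real ((2 * N * L) ^ D) * (unit_ball_vol (real D) * (real D / real N / 2) ^ D))"
      by (simp add: ennreal_mult ennreal_of_nat_eq_real_of_nat)
    also have "real ((2 * N * L) ^ D) * (unit_ball_vol (real D) * (real D / real N / 2) ^ D)
        = unit_ball_vol (real D) * (real D * real L) ^ D"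
    proof -
      have "real D * real L = real (2 * N * L) * (real D / real N / 2)" using N by simp
      then show ?thesis
        by (simp only: of_nat_power) (simp only: power_mult_distrib mult_ac)
    qed
    finally show ?thesis .
  qed
  then have "hausdorff_outer D ?A \<le> ennreal (unit_ball_vol (real D) * (real D * real L) ^ D)"
    by (rule hausdorff_outer_le)
  then show ?thesis by (auto simp: D_def intro: le_less_trans)
qed

text \<open>The Jacobian factor is a power of \<open>\<bar>c\<bar>\<close>. Translations
  (\<open>c = 1\<close>) and point reflections (\<open>c = -1\<close>) both occur as slices in the
  uniqueness argument that follows.\<close>

lemma emeasure_lborel_affine_preimage:
  fixes A :: "'m::euclidean_space set"
  assumes [measurable]: "A \<in> sets borel" and c: "\<bar>c\<bar> = 1"
  shows "emeasure lborel {y. z + c *\<^sub>R y \<in> A} = emeasure lborel A"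
proof -
  have "(lborel :: 'm measure)
      = density (distr lborel borel (\<lambda>x. z + c *\<^sub>R x)) (\<lambda>_. ennreal (\<bar>c\<bar> ^ DIM('m)))"
    by (rule lborel_affine) (use c in auto)
  then have "emeasure lborel A = emeasure (density (distr lborel borel (\<lambda>x. z + c *\<^sub>R x)) (\<lambda>_. 1)) A"
    by (simp add: c)
  also have "\<dots> = emeasure lborel {y. z + c *\<^sub>R y \<in> A}"
    by (simp add: density_1 emeasure_distr vimage_def)
  finally show ?thesis by simp
qed

text \<open>Both products equal the measure of \<open>{(x, y). x \<in> A \<and> x + y \<in> B}\<close>: integrate first over
  \<open>y\<close>, or first shift \<open>x\<close> by \<open>y\<close>.\<close>

lemma translation_invariant_mult_lborel:
  fixes N :: "'m::euclidean_space measure"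
  assumes "sigma_finite_measure N" and [simp, measurable_cong]: "sets N = sets borel"
    and inv: "\<And>A y. A \<in> sets borel \<Longrightarrow> emeasure N {x. x + y \<in> A} = emeasure N A"
    and [measurable]: "A \<in> sets borel" "B \<in> sets borel"
  shows "emeasure N A * emeasure lborel B = emeasure N B * emeasure lborel A"
proof -
  interpret N: sigma_finite_measure N by fact
  interpret pair_sigma_finite N "lborel :: 'm measure"
    by unfold_locales
  have [simp]: "space N = UNIV"
    using sets_eq_imp_space_eq[OF assms(2)] by simp
  \<comment> \<open>\<open>F\<close> is the image of \<open>E\<close> under the shear
    \<open>(x, y) \<mapsto> (x + y, y)\<close>. For fixed \<open>y\<close> the slice of
    \<open>E\<close> is a translate of the slice of \<open>F\<close>, which is where the invariance
    of \<open>N\<close> enters.\<close>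
  define E where "E = {p :: 'm \<times> 'm. fst p \<in> A \<and> fst p + snd p \<in> B}"
  define F where "F = {p :: 'm \<times> 'm. fst p \<in> B \<and> fst p - snd p \<in> A}"
  have E [measurable]: "E \<in> sets (N \<Otimes>\<^sub>M lborel)"
  proof -
    have "{p \<in> space (N \<Otimes>\<^sub>M lborel). fst p \<in> A \<and> fst p + snd p \<in> B} \<in> sets (N \<Otimes>\<^sub>M (lborel :: 'm measure))"
      by measurable
    then show ?thesis by (simp add: E_def space_pair_measure)
  qed
  have F [measurable]: "F \<in> sets (N \<Otimes>\<^sub>M lborel)"
  proof -
    have "{p \<in> space (N \<Otimes>\<^sub>M lborel). fst p \<in> B \<and> fst p - snd p \<in> A} \<in> sets (N \<Otimes>\<^sub>M (lborel :: 'm measure))"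
      by measurable
    then show ?thesis by (simp add: F_def space_pair_measure)
  qed
  have "emeasure (N \<Otimes>\<^sub>M lborel) E = (\<integral>\<^sup>+x. emeasure lborel (Pair x -` E) \<partial>N)"
    by (rule sigma_finite_measure.emeasure_pair_measure_alt[OF sigma_finite_lborel E])
  also have "\<dots> = (\<integral>\<^sup>+x. emeasure lborel B * indicator A x \<partial>N)"
  proof (rule nn_integral_cong)
    fix x
    have "Pair x -` E = (if x \<in> A then {y. x + y \<in> B} else {})" by (auto simp: E_def)
    then show "emeasure lborel (Pair x -` E) = emeasure lborel B * indicator A x"
      using emeasure_lborel_affine_preimage[of B 1 x] by simp
  qed
  also have "\<dots> = emeasure lborel B * emeasure N A"
    by (simp add: nn_integral_cmult_indicator)
  finally have 1: "emeasure (N \<Otimes>\<^sub>M lborel) E = emeasure lborel B * emeasure N A" .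
  have "emeasure (N \<Otimes>\<^sub>M lborel) F = (\<integral>\<^sup>+x. emeasure lborel (Pair x -` F) \<partial>N)"
    by (rule sigma_finite_measure.emeasure_pair_measure_alt[OF sigma_finite_lborel F])
  also have "\<dots> = (\<integral>\<^sup>+x. emeasure lborel A * indicator B x \<partial>N)"
  proof (rule nn_integral_cong)
    fix x
    have "Pair x -` F = (if x \<in> B then {y. x - y \<in> A} else {})" by (auto simp: F_def)
    then show "emeasure lborel (Pair x -` F) = emeasure lborel A * indicator B x"
      using emeasure_lborel_affine_preimage[of A "-1" x] by simp
  qed
  also have "\<dots> = emeasure lborel A * emeasure N B"
    by (simp add: nn_integral_cmult_indicator)
  finally have 2: "emeasure (N \<Otimes>\<^sub>M lborel) F = emeasure lborel A * emeasure N B" .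
  have "emeasure (N \<Otimes>\<^sub>M lborel) E = (\<integral>\<^sup>+y. emeasure N ((\<lambda>x. (x, y)) -` E) \<partial>lborel)"
    by (rule emeasure_pair_measure_alt2[OF E])
  also have "\<dots> = (\<integral>\<^sup>+y. emeasure N ((\<lambda>x. (x, y)) -` F) \<partial>lborel)"
  proof (rule nn_integral_cong)
    fix y :: 'm
    have "(\<lambda>x. (x, y)) -` F = B \<inter> {x. x - y \<in> A}" by (auto simp: F_def)
    moreover have "(\<lambda>x. (x, y)) -` E = {x. x + y \<in> B \<inter> {x. x - y \<in> A}}" by (auto simp: E_def)
    moreover have "B \<inter> {x. x - y \<in> A} \<in> sets borel" by measurable
    ultimately show "emeasure N ((\<lambda>x. (x, y)) -` E) = emeasure N ((\<lambda>x. (x, y)) -` F)"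
      using inv by (simp only:)
  qed
  also have "\<dots> = emeasure (N \<Otimes>\<^sub>M lborel) F"
    by (rule emeasure_pair_measure_alt2[OF F, symmetric])
  finally show ?thesis using 1 2 by (simp add: mult.commute)
qed

text \<open>With the normalisation in the definition the constant is 1, by the isodiametric inequality,
  but its value is irrelevant to the energy law.\<close>

lemma hausdorff_outer_eq_lborel:
  "\<exists>c\<ge>0. \<forall>A\<in>sets borel. hausdorff_outer DIM('m) (A :: 'm::euclidean_space set)
      = ennreal c * emeasure lborel A"
proof -
  \<comment> \<open>Pushing forward along the identity restricts the Hausdorff measure to the Borel
    sets, as the uniqueness lemma requires.\<close>
  define N where "N = distr (hausdorff_measure DIM('m)) borel (\<lambda>x :: 'm. x)"
  have meas: "(\<lambda>x :: 'm. x) \<in> measurable (hausdorff_measure DIM('m)) borel"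
    using borel_subset_hausdorff by (auto simp: measurable_def)
  have N: "emeasure N A = hausdorff_outer DIM('m) A" if "A \<in> sets borel" for A
    using that by (simp add: N_def emeasure_distr[OF meas] emeasure_hausdorff_measure borel_in_sets_hausdorff)
  have sN [simp]: "sets N = sets borel" by (simp add: N_def)
  have "sigma_finite_measure N"
  proof
    let ?C = "range (\<lambda>L::nat. box (- real L *\<^sub>R One) (real L *\<^sub>R One :: 'm))"
    show "\<exists>A. countable A \<and> A \<subseteq> sets N \<and> \<Union> A = space N \<and> (\<forall>a\<in>A. emeasure N a \<noteq> \<infinity>)"
    proof (intro exI[of _ ?C] conjI ballI)
      show "\<Union> ?C = space N" using UN_box_eq_UNIV[where 'a = 'm] by (simp add: N_def)
      fix a assume "a \<in> ?C"
      then show "emeasure N a \<noteq> \<infinity>"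
        using hausdorff_outer_cube_finite[where 'm = 'm] by (auto simp: N less_top)
    qed auto
  qed
  moreover have "emeasure N {x. x + y \<in> A} = emeasure N A" if A [measurable]: "A \<in> sets borel" for A y
  proof -
    have "{x. x + y \<in> A} \<in> sets borel" by measurable
    moreover have "(\<lambda>x. x + y) ` {x. x + y \<in> A} = A"
      by (auto intro!: image_eqI[of _ _ "_ - y"])
    ultimately show ?thesis
      using hausdorff_outer_isometric_image[of "\<lambda>x. x + y" "DIM('m)" "{x. x + y \<in> A}"] that
      by (simp add: N)
  qed
  ultimately have *: "emeasure N A * emeasure lborel (box 0 One :: 'm set)
      = emeasure N (box 0 One :: 'm set) * emeasure lborel A" if "A \<in> sets borel" for A
    using that by (intro translation_invariant_mult_lborel) auto
  \<comment> \<open>The unit box has Lebesgue measure 1, so the constant is its Hausdorff measure,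
    which is finite by comparison with a cube.\<close>
  have "emeasure N (box 0 One :: 'm set) \<le> emeasure N (box (- real 1 *\<^sub>R One) (real 1 *\<^sub>R One :: 'm))"
    by (intro emeasure_mono subset_box_imp) auto
  also have "\<dots> < top"
    using hausdorff_outer_cube_finite[where 'm = 'm, of 1] by (simp add: N)
  finally obtain c where c: "c \<ge> 0" "emeasure N (box 0 One :: 'm set) = ennreal c"
    by (cases "emeasure N (box 0 One :: 'm set)") (auto simp: top_unique)
  have "emeasure lborel (box 0 One :: 'm set) = 1"
    by (simp add: emeasure_lborel_box inner_diff_left)
  then have "hausdorff_outer DIM('m) A = ennreal c * emeasure lborel A"
    if "A \<in> sets borel" for A :: "'m set"
    using *[OF that] c that by (simp add: N)
  then show ?thesis using c by blast
qed

subsection \<open>Area of simplices\<close>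

lemma rel_interior_in_borel:
  fixes K :: "'a::euclidean_space set"
  shows "rel_interior K \<in> sets borel"
proof -
  obtain U where "open U" "rel_interior K = affine hull K \<inter> U"
    using openin_rel_interior[of K] by (auto simp: openin_open)
  then show ?thesis
    by (auto intro!: sets.Int borel_open borel_closed closed_affine_hull)
qed

text \<open>The hull is modelled in a space of its own dimension, where its relative interior is an
  interior and its frontier is Lebesgue null by convexity. The affine isometry carries both facts
  over to \<open>K\<close>.\<close>

lemma hausdorff_outer_isometric_convex_hull:
  fixes g :: "'m::euclidean_space \<Rightarrow> 'n::euclidean_space"
  assumes "linear g" and norm: "\<And>x. norm (g x) = norm x"
    and "finite V" and int: "interior (convex hull V) \<noteq> {}"
    and c: "\<forall>A\<in>sets borel. hausdorff_outer DIM('m) (A :: 'm set) = ennreal c * emeasure lborel A"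
    and K: "K = convex hull ((\<lambda>x. a + g x) ` V)"
  shows "hausdorff_outer DIM('m) (rel_interior K) = ennreal c * ennreal (measure lborel (convex hull V))"
    and "hausdorff_outer DIM('m) (K - rel_interior K) = 0"
proof -
  let ?f = "\<lambda>x. a + g x"
  let ?P = "convex hull V"
  have iso: "dist (?f x) (?f y) = dist x y" for x y
    using norm[of "x - y"] \<open>linear g\<close> by (simp add: dist_norm linear_diff)
  have "inj g"
    using norm \<open>linear g\<close> by (metis linear_injective_0 norm_eq_zero)
  have f: "?f ` A = (+) a ` g ` A" for A by auto
  have KP: "K = ?f ` ?P"
    unfolding K f convex_hull_translation convex_hull_linear_image[OF \<open>linear g\<close>] by simp
  have RP: "rel_interior K = ?f ` interior ?P"
    unfolding KP f rel_interior_translation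
    using \<open>linear g\<close> \<open>inj g\<close> int
    by (simp add: rel_interior_injective_linear_image linear_conv_bounded_linear rel_interior_nonempty_interior)
  have cl: "compact ?P"
    using \<open>finite V\<close> by (simp add: finite_imp_compact_convex_hull)
  have "negligible (?P - interior ?P)"
    using cl negligible_convex_frontier[of ?P]
    by (simp add: frontier_def compact_imp_closed closure_closed)
  moreover have meas: "?P - interior ?P \<in> sets borel"
    using cl by (intro sets.Diff borel_compact borel_open) auto
  ultimately have null: "emeasure lborel (?P - interior ?P) = 0"
    by (simp add: negligible_iff_null_sets null_sets_completion_iff) auto
  have "K - rel_interior K = ?f ` (?P - interior ?P)"
    unfolding RP unfolding KP using inj_eq[OF \<open>inj g\<close>] by auto
  then show "hausdorff_outer DIM('m) (K - rel_interior K) = 0"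
    using hausdorff_outer_isometric_image[of ?f] iso c meas null by simp
  have "emeasure lborel ?P = emeasure lborel (interior ?P \<union> (?P - interior ?P))"
    using interior_subset[of ?P] by (metis Un_Diff_cancel sup.absorb2)
  also have "\<dots> = emeasure lborel (interior ?P)"
    using meas null by (intro emeasure_Un_null_set) auto
  finally have "emeasure lborel (interior ?P) = ennreal (measure lborel ?P)"
    using emeasure_eq_ennreal_measure[of lborel ?P] emeasure_compact_finite[OF cl] by simp
  then show "hausdorff_outer DIM('m) (rel_interior K) = ennreal c * ennreal (measure lborel ?P)"
    unfolding RP using hausdorff_outer_isometric_image[of ?f] iso c by simp
qed

text \<open>The root of the Gram determinant; by Lagrange's identity it is the length of the cross
  product in three dimensions. It involves inner products only and so can be differentiated along
  moving edges.\<close>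

definition parallelogram_area :: "'n::euclidean_space \<Rightarrow> 'n \<Rightarrow> real" where
  "parallelogram_area w1 w2 = sqrt ((w1 \<bullet> w1) * (w2 \<bullet> w2) - (w1 \<bullet> w2)\<^sup>2)"

text \<open>The constant is quantified before the endpoints, hence is shared by all segments at all
  times. The model is the interval from 0 to the length, laid along the unit direction of the
  segment.\<close>

lemma hausdorff_outer_segment:
  "\<exists>c\<ge>0. \<forall>a b :: 'n::euclidean_space. a \<noteq> b \<longrightarrow>
     hausdorff_outer 1 (rel_interior (convex hull {a, b})) = ennreal (c * norm (b - a)) \<and>
     hausdorff_outer 1 (convex hull {a, b} - rel_interior (convex hull {a, b})) = 0"
proof -
  obtain c where c: "c \<ge> 0"
    "\<forall>A\<in>sets borel. hausdorff_outer DIM(real) (A :: real set) = ennreal c * emeasure lborel A"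
    using hausdorff_outer_eq_lborel[where 'm = real] by blast
  show ?thesis
  proof (intro exI[of _ c] conjI c allI impI)
    fix a b :: 'n assume "a \<noteq> b"
    define l where "l = norm (b - a)"
    define g where "g s = s *\<^sub>R ((b - a) /\<^sub>R l)" for s
    have l: "l > 0" using \<open>a \<noteq> b\<close> by (simp add: l_def)
    have lin: "linear g" unfolding g_def by (intro linearI) (auto simp: algebra_simps)
    have nrm: "norm (g s) = norm s" for s
      using l by (simp add: g_def abs_mult flip: l_def)
    have hull: "convex hull {0, l} = {0..l}"
      using l by (simp add: segment_convex_hull[symmetric] closed_segment_eq_real_ivl)
    have K: "convex hull {a, b} = convex hull ((\<lambda>s. a + g s) ` {0, l})"
      using l by (simp add: g_def)
    have int: "interior (convex hull {0, l}) \<noteq> {}"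
      using l by (simp add: hull)
    have "measure lborel {0..l} = l" using l by simp
    then show "hausdorff_outer 1 (rel_interior (convex hull {a, b})) = ennreal (c * norm (b - a))"
      using hausdorff_outer_isometric_convex_hull(1)[OF lin nrm _ int c(2) K] l c(1)
      by (simp add: hull ennreal_mult l_def[symmetric])
    show "hausdorff_outer 1 (convex hull {a, b} - rel_interior (convex hull {a, b})) = 0"
      using hausdorff_outer_isometric_convex_hull(2)[OF lin nrm _ int c(2) K] by simp
  qed
qed

text \<open>Strict Cauchy-Schwarz: equality holds exactly when the two vectors are collinear with
  0.\<close>

lemma not_collinear_gram_pos:
  fixes w1 w2 :: "'n::euclidean_space"
  assumes "\<not> collinear {0, w1, w2}"
  shows "(w1 \<bullet> w1) * (w2 \<bullet> w2) - (w1 \<bullet> w2)\<^sup>2 > 0"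
proof -
  have "\<bar>w1 \<bullet> w2\<bar> \<noteq> norm w1 * norm w2" "\<bar>w1 \<bullet> w2\<bar> \<le> norm w1 * norm w2"
    using assms norm_cauchy_schwarz_equal Cauchy_Schwarz_ineq2 by blast+
  then have "\<bar>w1 \<bullet> w2\<bar>\<^sup>2 < (norm w1 * norm w2)\<^sup>2"
    by (intro power_strict_mono) auto
  then show ?thesis
    by (simp add: power_mult_distrib power2_norm_eq_inner)
qed

text \<open>Gram-Schmidt on the two edges gives an orthonormal pair \<open>u\<close>,
  \<open>v\<close> and the planar model with vertices (0,0), (l,0), (p,h): \<open>l\<close> is the
  base, \<open>h\<close> the height and \<open>p\<close> the signed offset of its foot.\<close>

lemma hausdorff_outer_triangle:
  "\<exists>c\<ge>0. \<forall>a b d :: 'n::euclidean_space. \<not> collinear {0, b - a, d - a} \<longrightarrow>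
     hausdorff_outer 2 (rel_interior (convex hull {a, b, d})) = ennreal (c * parallelogram_area (b - a) (d - a)) \<and>
     hausdorff_outer 2 (convex hull {a, b, d} - rel_interior (convex hull {a, b, d})) = 0"
proof -
  obtain c where c: "c \<ge> 0"
    "\<forall>A\<in>sets borel. hausdorff_outer DIM(real^2) (A :: (real^2) set) = ennreal c * emeasure lborel A"
    using hausdorff_outer_eq_lborel[where 'm = "real^2"] by blast
  show ?thesis
  \<comment> \<open>The factor 1/2 is the share of the triangle in the parallelogram.\<close>
  proof (intro exI[of _ "c / 2"] conjI allI impI)
    fix a b d :: 'n assume nc: "\<not> collinear {0, b - a, d - a}"
    define w1 where "w1 = b - a"
    define w2 where "w2 = d - a"
    note G = not_collinear_gram_pos[OF nc, folded w1_def w2_def]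
    define l where "l = norm w1"
    have "w1 \<noteq> 0" using nc by (auto simp: w1_def collinear_lemma)
    then have l: "l > 0" by (simp add: l_def)
    define u where "u = w1 /\<^sub>R l"
    have uu: "u \<bullet> u = 1" using l by (simp add: u_def l_def dot_square_norm power2_eq_square)
    define p where "p = w2 \<bullet> u"
    define r where "r = w2 - p *\<^sub>R u"
    define h where "h = norm r"
    have lp: "w1 \<bullet> w2 = l * p" using l by (simp add: p_def u_def inner_commute)
    have hh: "h * h = w2 \<bullet> w2 - p * p"
    proof -
      have "h * h = r \<bullet> r" by (simp add: h_def dot_square_norm power2_eq_square)
      then show ?thesis by (simp add: r_def inner_diff_left inner_diff_right uu p_def inner_commute)
    qed
    have ll: "w1 \<bullet> w1 = l * l" by (simp add: l_def dot_square_norm power2_eq_square)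
    have G_lh: "(w1 \<bullet> w1) * (w2 \<bullet> w2) - (w1 \<bullet> w2)\<^sup>2 = (l * h)\<^sup>2"
    proof -
      have "(l * h)\<^sup>2 = l * l * (h * h)" by (simp add: power2_eq_square)
      then show ?thesis unfolding hh lp ll by (simp add: power2_eq_square algebra_simps)
    qed
    have "h \<noteq> 0" using G G_lh by auto
    then have h: "h > 0" by (simp add: h_def)
    define v where "v = r /\<^sub>R h"
    have vv: "v \<bullet> v = 1" using h by (simp add: v_def h_def dot_square_norm power2_eq_square)
    have uv: "u \<bullet> v = 0"
      by (simp add: v_def r_def inner_diff_right uu p_def inner_commute)
    define g where "g x = x$1 *\<^sub>R u + x$2 *\<^sub>R v" for x :: "real^2"
    have lin: "linear g" unfolding g_def by (intro linearI) (auto simp: algebra_simps)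
    have nrm: "norm (g x) = norm x" for x
      by (simp add: g_def norm_eq_sqrt_inner inner_vec_def sum_2 inner_add_left inner_add_right uu uv vv
          inner_commute[of v u])
    let ?V = "{0, vector [l, 0], vector [p, h]} :: (real^2) set"
    have w1: "w1 = l *\<^sub>R u" using l by (simp add: u_def)
    have w2: "w2 = p *\<^sub>R u + h *\<^sub>R v" using h by (simp add: v_def r_def)
    have "g 0 = 0" "g (vector [l, 0]) = b - a" "g (vector [p, h]) = d - a"
      using w1 w2 by (auto simp: g_def w1_def w2_def)
    then have K: "convex hull {a, b, d} = convex hull ((\<lambda>x. a + g x) ` ?V)"
      by simp
    have ar: "measure lborel (convex hull ?V) = l * h / 2"
      using l h by (subst content_triangle) simp
    \<comment> \<open>A convex set with empty interior is negligible, which contradicts the positive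
      area just computed.\<close>
    then have int: "interior (convex hull ?V) \<noteq> {}"
      using l h negligible_convex_interior[of "convex hull ?V"] negligible_imp_measure0[of "convex hull ?V"]
      by (auto simp: measure_completion borel_compact finite_imp_compact_convex_hull)
    have "parallelogram_area (b - a) (d - a) = l * h"
      using G_lh l h by (simp add: parallelogram_area_def w1_def w2_def)
    then show "hausdorff_outer 2 (rel_interior (convex hull {a, b, d}))
        = ennreal (c / 2 * parallelogram_area (b - a) (d - a))"
      using hausdorff_outer_isometric_convex_hull(1)[OF lin nrm _ int c(2) K] l h c(1)
      by (simp add: ar ennreal_mult[symmetric])
    show "hausdorff_outer 2 (convex hull {a, b, d} - rel_interior (convex hull {a, b, d})) = 0"
      using hausdorff_outer_isometric_convex_hull(2)[OF lin nrm _ int c(2) K] by simp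
  qed (use c in auto)
qed

subsection \<open>Surface gradients of piecewise affine functions\<close>

lemma tangent_space_eq_span_diff:
  assumes "x \<in> \<sigma>"
  shows "tangent_space \<sigma> = span ((\<lambda>y. - x + y) ` \<sigma>)"
proof (rule antisym)
  show "tangent_space \<sigma> \<subseteq> span ((\<lambda>y. - x + y) ` \<sigma>)"
    unfolding tangent_space_def
  proof (rule span_minimal)
    show "{y - z |y z. y \<in> \<sigma> \<and> z \<in> \<sigma>} \<subseteq> span ((\<lambda>y. - x + y) ` \<sigma>)"
    proof clarify
      fix y z assume yz: "y \<in> \<sigma>" "z \<in> \<sigma>"
      have "y - z = (- x + y) - (- x + z)" by simp
      then show "y - z \<in> span ((\<lambda>y. - x + y) ` \<sigma>)"
        using yz by (metis image_eqI span_base span_diff)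
    qed
  qed simp
  show "span ((\<lambda>y. - x + y) ` \<sigma>) \<subseteq> tangent_space \<sigma>"
    unfolding tangent_space_def using assms by (intro span_mono) force
qed

lemma mem_tangent_space_iff:
  assumes "x \<in> \<sigma>"
  shows "h \<in> tangent_space \<sigma> \<longleftrightarrow> x + h \<in> affine hull \<sigma>"
  unfolding tangent_space_eq_span_diff[OF assms] affine_hull_span_gen[OF hull_inc[OF assms]]
  by auto

text \<open>Differences in \<open>tangent_space\<close> are taken within the open simplex, which a
  vertex need not belong to. The base point is moved from a relative interior point to the vertex
  \<open>a\<close> through the common affine hull.\<close>

lemma tangent_space_rel_interior_convex_hull:
  fixes V :: "(real^'n) set"
  assumes "a \<in> V"
  shows "tangent_space (rel_interior (convex hull V)) = span ((\<lambda>y. y - a) ` V)"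
proof -
  have "rel_interior (convex hull V) \<noteq> {}"
    using assms by (auto simp: rel_interior_eq_empty)
  then obtain x where x: "x \<in> rel_interior (convex hull V)" by blast
  have hull: "affine hull (rel_interior (convex hull V)) = affine hull V"
    by (simp add: rel_interior_same_affine_hull)
  have W: "affine hull V = (\<lambda>x. a + x) ` span ((\<lambda>y. y - a) ` V)"
    using affine_hull_span_gen[OF hull_inc[OF assms]] by simp
  have "x - a \<in> span ((\<lambda>y. y - a) ` V)"
    using hull_inc[OF x, of affine] unfolding hull W by auto
  then have "x + h \<in> affine hull V \<longleftrightarrow> h \<in> span ((\<lambda>y. y - a) ` V)" for h
    unfolding W using span_add_eq[of "x - a" _ h] by (force simp: image_iff algebra_simps)
  then show ?thesis
    using mem_tangent_space_iff[OF x] hull by auto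
qed

text \<open>Evaluates the definite description. Disjointness leaves one possible simplex; the
  derivative within it is determined along tangential directions only, and requiring the gradient to
  be tangential fixes the rest.\<close>

lemma surface_grad_eqI:
  fixes S :: "(real^'n) set set"
  assumes "disjoint S" "\<sigma> \<in> S" and \<sigma>: "\<sigma> = rel_interior K" "convex K" and "x \<in> \<sigma>"
    and g: "\<And>y. y \<in> \<sigma> \<Longrightarrow> g y = a + b \<bullet> y"
    and v: "v \<in> tangent_space \<sigma>" "\<And>h. h \<in> tangent_space \<sigma> \<Longrightarrow> v \<bullet> h = b \<bullet> h"
  shows "surface_grad S g x = v"
  unfolding surface_grad_def
proof (rule the_equality)
  have "((\<lambda>y. (a + b \<bullet> x) + v \<bullet> (y - x)) has_derivative (\<bullet>) v) (at x within \<sigma>)"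
    by (auto intro!: derivative_eq_intros)
  moreover have "g y = (a + b \<bullet> x) + v \<bullet> (y - x)" if "y \<in> \<sigma>" for y
  proof -
    have "y - x \<in> tangent_space \<sigma>"
      unfolding tangent_space_def using that \<open>x \<in> \<sigma>\<close> by (auto intro: span_base)
    from v(2)[OF this] show ?thesis using g[OF that] by (simp add: inner_diff_right)
  qed
  ultimately have "(g has_derivative (\<bullet>) v) (at x within \<sigma>)"
    using \<open>x \<in> \<sigma>\<close> by (rule_tac has_derivative_transform)
  then show "\<exists>\<tau>\<in>S. x \<in> \<tau> \<and> v \<in> tangent_space \<tau> \<and> (g has_derivative (\<bullet>) v) (at x within \<tau>)"
    using assms by blast
next
  fix w assume "\<exists>\<tau>\<in>S. x \<in> \<tau> \<and> w \<in> tangent_space \<tau> \<and> (g has_derivative (\<bullet>) w) (at x within \<tau>)"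
  then obtain \<tau> where \<tau>: "\<tau> \<in> S" "x \<in> \<tau>" "w \<in> tangent_space \<tau>" "(g has_derivative (\<bullet>) w) (at x within \<tau>)"
    by blast
  then have "\<tau> = \<sigma>" using assms by (auto simp: disjoint_def)
  note w = \<tau>(3,4)[unfolded this]
  have "w \<bullet> h = b \<bullet> h" if h: "h \<in> tangent_space \<sigma>" for h
  proof -
    have hull: "affine hull \<sigma> = affine hull K"
      using \<sigma> by (simp add: rel_interior_same_affine_hull)
    obtain e where e: "e > 0" "ball x e \<inter> affine hull K \<subseteq> \<sigma>"
      using openin_rel_interior[of K] \<open>x \<in> \<sigma>\<close> unfolding openin_contains_ball \<sigma>(1) by blast
    have line: "x + s *\<^sub>R h \<in> affine hull K" for s
      using h \<open>x \<in> \<sigma>\<close> mem_tangent_space_iff[of x \<sigma> "s *\<^sub>R h"] hull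
      by (simp add: tangent_space_def span_scale)
    \<comment> \<open>Since \<open>x\<close> is relatively interior, a short line through it in
      direction \<open>h\<close> stays in the simplex. Restricting \<open>g\<close> to this line
      reduces uniqueness to derivatives in one variable.\<close>
    define P where "P = (\<lambda>s. x + s *\<^sub>R h)"
    define I where "I = {s. norm (s *\<^sub>R h) < e}"
    have I: "open I" "0 \<in> I"
      using \<open>e > 0\<close> unfolding I_def by (auto intro!: open_Collect_less continuous_intros)
    have PI: "P ` I \<subseteq> \<sigma>"
      using e(2) line by (auto simp: P_def I_def dist_norm)
    have dP: "(P has_derivative (\<lambda>s. s *\<^sub>R h)) (at 0 within I)"
      unfolding P_def by (auto intro!: derivative_eq_intros)
    have "P 0 = x" by (simp add: P_def)
    then have "(g has_derivative (\<bullet>) w) (at (P 0) within P ` I)"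
      using has_derivative_subset[OF w(2) PI] by simp
    from has_derivative_in_compose[OF dP this]
    have 1: "((\<lambda>s. g (P s)) has_derivative (\<lambda>s. w \<bullet> (s *\<^sub>R h))) (at 0)"
      unfolding at_within_open[OF I(2,1)] .
    have "((\<lambda>s. a + b \<bullet> P s) has_derivative (\<lambda>s. b \<bullet> (s *\<^sub>R h))) (at 0)"
      unfolding P_def by (auto intro!: derivative_eq_intros)
    then have 2: "((\<lambda>s. g (P s)) has_derivative (\<lambda>s. b \<bullet> (s *\<^sub>R h))) (at 0)"
      by (rule has_derivative_transform_within_open[OF _ I]) (use PI g in auto)
    show ?thesis
      using fun_cong[OF has_derivative_unique[OF 1 2], of 1] by simp
  qed
  then have "(w - v) \<bullet> h = 0" if "h \<in> tangent_space \<sigma>" for h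
    using v(2)[OF that] that by (simp add: inner_diff_left)
  moreover have "w - v \<in> tangent_space \<sigma>"
    using w(1) v(1) unfolding tangent_space_def by (rule span_diff)
  ultimately have "(w - v) \<bullet> (w - v) = 0" by blast
  then show "w = v" by simp
qed

text \<open>The sum is the tangential projection of \<open>b\<close>: it is tangential and agrees
  with \<open>b\<close> on the edges, which span the tangent space. The dual basis is taken as given
  because the area computation supplies explicit vectors.\<close>

lemma surface_grad_dual_basis:
  fixes S :: "(real^'n) set set" and p :: "'i \<Rightarrow> real^'n"
  assumes "disjoint S" "\<sigma> \<in> S" "\<sigma> = rel_interior (convex hull (p ` J))" "x \<in> \<sigma>"
    and "finite J" "j0 \<in> J"
    and g: "\<And>y. y \<in> \<sigma> \<Longrightarrow> g y = a + b \<bullet> y"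
    and d: "\<And>j. j \<in> J - {j0} \<Longrightarrow> d j \<in> span ((\<lambda>j. p j - p j0) ` J)"
    and dual: "\<And>i j. i \<in> J - {j0} \<Longrightarrow> j \<in> J - {j0} \<Longrightarrow> d i \<bullet> (p j - p j0) = (if i = j then 1 else 0)"
  shows "surface_grad S g x = (\<Sum>j\<in>J - {j0}. (b \<bullet> (p j - p j0)) *\<^sub>R d j)"
    and "(\<Sum>j\<in>J - {j0}. (b \<bullet> (p j - p j0)) *\<^sub>R d j) \<in> tangent_space \<sigma>"
    and "h \<in> tangent_space \<sigma> \<Longrightarrow> (\<Sum>j\<in>J - {j0}. (b \<bullet> (p j - p j0)) *\<^sub>R d j) \<bullet> h = b \<bullet> h"
proof -
  let ?v = "\<Sum>j\<in>J - {j0}. (b \<bullet> (p j - p j0)) *\<^sub>R d j"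
  have T: "tangent_space \<sigma> = span ((\<lambda>j. p j - p j0) ` J)"
    using assms(6) tangent_space_rel_interior_convex_hull[of "p j0" "p ` J"] assms(3)
    by (simp add: image_image)
  show v: "?v \<in> tangent_space \<sigma>"
    unfolding T by (intro span_sum span_scale d)
  have gen: "?v \<bullet> (p k - p j0) = b \<bullet> (p k - p j0)" if "k \<in> J" for k
  proof (cases "k = j0")
    case False
    then have k: "k \<in> J - {j0}" using that by simp
    have "?v \<bullet> (p k - p j0) = (\<Sum>j\<in>J - {j0}. if j = k then b \<bullet> (p j - p j0) else 0)"
      unfolding inner_sum_left using dual k by (intro sum.cong) auto
    then show ?thesis using k \<open>finite J\<close> by simp
  qed simp
  show eq: "?v \<bullet> h = b \<bullet> h" if "h \<in> tangent_space \<sigma>" for h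
    using that unfolding T
  proof (induction rule: span_induct_alt)
    case (step c x y)
    then show ?case using gen by (auto simp: inner_add_right)
  qed simp
  show "surface_grad S g x = ?v"
    by (rule surface_grad_eqI[OF assms(1,2,3) _ assms(4) g v eq]) auto
qed

text \<open>The surface gradient of the \<open>i\<close>-th coordinate is the projection of the
  \<open>i\<close>-th unit vector. Against a tangential vector it just picks the \<open>i\<close>-th
  entry, and summing over \<open>i\<close> gives the surface divergence of
  \<open>\<eta>\<close>.\<close>

lemma surface_grad_vec_identity_inner:
  fixes S :: "(real^'n) set set" and p :: "'i \<Rightarrow> real^'n"
  assumes "disjoint S" "\<sigma> \<in> S" "\<sigma> = rel_interior (convex hull (p ` J))" "x \<in> \<sigma>"
    and "finite J" "j0 \<in> J"
    and d: "\<And>j. j \<in> J - {j0} \<Longrightarrow> d j \<in> span ((\<lambda>j. p j - p j0) ` J)"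
    and dual: "\<And>i j. i \<in> J - {j0} \<Longrightarrow> j \<in> J - {j0} \<Longrightarrow> d i \<bullet> (p j - p j0) = (if i = j then 1 else 0)"
    and X: "\<And>y. y \<in> surface S \<Longrightarrow> X y = y"
    and \<eta>: "\<eta> \<in> V_space S" "\<And>j. j \<in> J \<Longrightarrow> \<eta> (p j) = r j"
  shows "surface_grad_vec S X x \<bullet> surface_grad_vec S \<eta> x = (\<Sum>j\<in>J - {j0}. d j \<bullet> (r j - r j0))"
proof -
  note dual_basis = surface_grad_dual_basis[OF assms(1-6) _ d dual]
  have closure_sub: "closure \<sigma> \<subseteq> surface S" using assms(2) by (auto simp: surface_def)
  have pcl: "p j \<in> closure \<sigma>" if "j \<in> J" for j
    using that by (simp add: assms(3) convex_closure_rel_interior hull_inc closure_subset[THEN subsetD])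
  have "\<exists>a b. \<forall>y\<in>\<sigma>. \<eta> y $ i = a + b \<bullet> y" for i
    using \<eta>(1) assms(2) by (auto simp: V_space_def W_space_def)
  then obtain a b where ab: "\<And>i y. y \<in> \<sigma> \<Longrightarrow> \<eta> y $ i = a i + b i \<bullet> y" by metis
  \<comment> \<open>The affine formula is given on the open simplex, while the nodal values are at
    its vertices; continuity extends the formula to the closure.\<close>
  have "\<eta> z $ i - (a i + b i \<bullet> z) = 0" if "z \<in> closure \<sigma>" for i z
  proof (rule continuous_constant_on_closure[OF _ _ that])
    have "continuous_on (closure \<sigma>) (\<lambda>y. \<eta> y $ i)"
      using \<eta>(1) closure_sub by (auto simp: V_space_def W_space_def intro: continuous_on_subset)
    then show "continuous_on (closure \<sigma>) (\<lambda>z. \<eta> z $ i - (a i + b i \<bullet> z))"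
      by (auto intro!: continuous_intros)
  qed (simp add: ab)
  then have \<eta>_cl: "\<eta> z $ i = a i + b i \<bullet> z" if "z \<in> closure \<sigma>" for i z
    using that by fastforce
  have b: "b i \<bullet> (p j - p j0) = (r j - r j0) $ i" if "j \<in> J" for i j
  proof -
    have "\<eta> (p k) $ i = a i + b i \<bullet> p k" if "k \<in> J" for k
      by (rule \<eta>_cl[OF pcl[OF that]])
    from this[OF that] this[OF \<open>j0 \<in> J\<close>] show ?thesis
      using \<eta>(2)[OF that] \<eta>(2)[OF \<open>j0 \<in> J\<close>] by (simp add: inner_diff_right)
  qed
  have gX: "surface_grad S (\<lambda>y. X y $ i) x = (\<Sum>j\<in>J - {j0}. (axis i 1 \<bullet> (p j - p j0)) *\<^sub>R d j)" for i
  proof (rule dual_basis(1)[of _ 0])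
    fix y assume "y \<in> \<sigma>"
    then have "y \<in> surface S" using closure_sub closure_subset by blast
    then show "X y $ i = 0 + axis i 1 \<bullet> y" by (simp add: X inner_axis')
  qed
  have "surface_grad S (\<lambda>y. X y $ i) x \<bullet> surface_grad S (\<lambda>y. \<eta> y $ i) x
      = (\<Sum>j\<in>J - {j0}. (r j - r j0) $ i * d j $ i)" for i
  proof -
    have ab_i: "\<eta> y $ i = a i + b i \<bullet> y" if "y \<in> \<sigma>" for y by (rule ab[OF that])
    have g\<eta>: "surface_grad S (\<lambda>y. \<eta> y $ i) x = (\<Sum>j\<in>J - {j0}. (b i \<bullet> (p j - p j0)) *\<^sub>R d j)"
      by (rule dual_basis(1)[of _ "a i"]) (rule ab_i)
    \<comment> \<open>The gradient of the component of \<open>\<eta>\<close> is tangential, so the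
      projected unit vector may be replaced by the unit vector itself.\<close>
    have "surface_grad S (\<lambda>y. X y $ i) x \<bullet> surface_grad S (\<lambda>y. \<eta> y $ i) x
        = axis i 1 \<bullet> surface_grad S (\<lambda>y. \<eta> y $ i) x"
      unfolding gX g\<eta>
    proof (rule dual_basis(3)[of "\<lambda>y. axis i 1 \<bullet> y" 0])
      show "(\<Sum>j\<in>J - {j0}. (b i \<bullet> (p j - p j0)) *\<^sub>R d j) \<in> tangent_space \<sigma>"
        by (rule dual_basis(2)[of "\<lambda>y. \<eta> y $ i" "a i"]) (rule ab_i)
    qed simp
    also have "\<dots> = (\<Sum>j\<in>J - {j0}. (b i \<bullet> (p j - p j0)) * d j $ i)"
      unfolding g\<eta> by (simp only: inner_axis' sum_component vector_scaleR_component mult_1 inner_real_def real_scaleR_def)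
    also have "\<dots> = (\<Sum>j\<in>J - {j0}. (r j - r j0) $ i * d j $ i)"
    proof (rule sum.cong[OF refl])
      fix j assume "j \<in> J - {j0}"
      then have "j \<in> J" by blast
      then show "b i \<bullet> (p j - p j0) * d j $ i = (r j - r j0) $ i * d j $ i" by (simp only: b)
    qed
    finally show ?thesis .
  qed
  then have "surface_grad_vec S X x \<bullet> surface_grad_vec S \<eta> x
      = (\<Sum>i\<in>UNIV. \<Sum>j\<in>J - {j0}. (r j - r j0) $ i * d j $ i)"
    unfolding surface_grad_vec_def inner_vec_def[of "\<chi> i. surface_grad S (\<lambda>y. X y $ i) x"]
    by (simp only: vec_lambda_beta)
  also have "\<dots> = (\<Sum>j\<in>J - {j0}. \<Sum>i\<in>UNIV. (r j - r j0) $ i * d j $ i)"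
    by (rule sum.swap)
  also have "\<dots> = (\<Sum>j\<in>J - {j0}. d j \<bullet> (r j - r j0))"
    by (simp only: inner_vec_def inner_real_def mult.commute)
  finally show ?thesis .
qed

subsection \<open>Rate of change of the area of a moving simplex\<close>

text \<open>Area times half the logarithmic derivative of \<open>G\<close>; in this form the unknown
  constant stays hidden inside the area.\<close>

lemma has_real_derivative_mult_sqrt:
  assumes "(G has_real_derivative G') (at t within I)" "G t > 0"
  shows "((\<lambda>s. c * sqrt (G s)) has_real_derivative c * sqrt (G t) * (G' / (2 * G t))) (at t within I)"
proof -
  have "((\<lambda>s. c * sqrt (G s)) has_real_derivative c * (G' * (inverse (sqrt (G t)) / 2))) (at t within I)"
    using assms by (auto intro!: derivative_eq_intros)
  moreover have "inverse (sqrt (G t)) = sqrt (G t) / G t"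
    using assms(2) by (simp add: real_div_sqrt inverse_eq_divide divide_eq_eq eq_divide_eq)
  then have "c * (G' * (inverse (sqrt (G t)) / 2)) = c * sqrt (G t) * (G' / (2 * G t))"
    by (simp add: mult_ac)
  ultimately show ?thesis by metis
qed

lemma has_real_derivative_inner:
  assumes "(f has_vector_derivative f') (at t within I)" "(g has_vector_derivative g') (at t within I)"
  shows "((\<lambda>s. f s \<bullet> g s) has_real_derivative f t \<bullet> g' + f' \<bullet> g t) (at t within I)"
  using bounded_bilinear.has_vector_derivative[OF bounded_bilinear_inner assms]
  by (simp add: has_real_derivative_iff_has_vector_derivative)

text \<open>The rates are expressed by a basis dual to the edge vectors, so that they match the surface
  divergence of the vertex velocity.\<close>

lemma segment_area_rate:
  fixes q :: "nat \<Rightarrow> real \<Rightarrow> 'n::euclidean_space"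
  assumes "i \<noteq> j" and ne: "\<And>s. s \<in> I \<Longrightarrow> q i s \<noteq> q j s"
    and q: "\<And>k s. k \<in> {i, j} \<Longrightarrow> s \<in> I \<Longrightarrow> (q k has_vector_derivative r k s) (at s within I)"
  shows "\<exists>A. (\<forall>s\<in>I. A s \<ge> 0 \<and>
        hausdorff_outer 1 (rel_interior (convex hull {q i s, q j s})) = ennreal (A s) \<and>
        hausdorff_outer 1 (convex hull {q i s, q j s} - rel_interior (convex hull {q i s, q j s})) = 0) \<and>
      (\<forall>t\<in>I. \<exists>d. d \<in> span {q j t - q i t} \<and> d \<bullet> (q j t - q i t) = 1 \<and>
        (A has_real_derivative A t * (d \<bullet> (r j t - r i t))) (at t within I))"
proof -
  obtain c where c: "c \<ge> 0" and H: "\<forall>a b :: 'n. a \<noteq> b \<longrightarrow>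
     hausdorff_outer 1 (rel_interior (convex hull {a, b})) = ennreal (c * norm (b - a)) \<and>
     hausdorff_outer 1 (convex hull {a, b} - rel_interior (convex hull {a, b})) = 0"
    using hausdorff_outer_segment[where 'n = 'n] by blast
  define w where "w s = q j s - q i s" for s
  define A where "A s = c * sqrt (w s \<bullet> w s)" for s
  have A_norm: "A s = c * norm (q j s - q i s)" for s
    by (simp add: A_def w_def norm_eq_sqrt_inner)
  have "\<exists>d. d \<in> span {q j t - q i t} \<and> d \<bullet> (q j t - q i t) = 1 \<and>
        (A has_real_derivative A t * (d \<bullet> (r j t - r i t))) (at t within I)" if t: "t \<in> I" for t
  proof -
    define w' where "w' = r j t - r i t"
    define d where "d = w t /\<^sub>R (w t \<bullet> w t)"
    have pos: "w t \<bullet> w t > 0" using ne[OF t] by (simp add: w_def)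
    have "(w has_vector_derivative w') (at t within I)"
      unfolding w_def w'_def using t by (auto intro!: derivative_intros q)
    from has_real_derivative_inner[OF this this]
    have "((\<lambda>s. w s \<bullet> w s) has_real_derivative w t \<bullet> w' + w' \<bullet> w t) (at t within I)" .
    from has_real_derivative_mult_sqrt[OF this pos, of c]
    have "(A has_real_derivative A t * ((w t \<bullet> w' + w' \<bullet> w t) / (2 * (w t \<bullet> w t)))) (at t within I)"
      by (simp add: A_def[abs_def])
    moreover have "(w t \<bullet> w' + w' \<bullet> w t) / (2 * (w t \<bullet> w t)) = d \<bullet> w'"
      using pos by (simp add: d_def inner_commute field_simps)
    ultimately have "(A has_real_derivative A t * (d \<bullet> w')) (at t within I)" by metis
    moreover have "d \<bullet> w t = 1" using pos by (simp add: d_def)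
    moreover have "d \<in> span {w t}" by (simp add: d_def span_base span_scale)
    ultimately show ?thesis by (intro exI[of _ d]) (simp add: w_def w'_def)
  qed
  then show ?thesis
    using H ne c by (intro exI[of _ A]) (auto simp: A_norm)
qed

text \<open>Jacobi's formula for the 2x2 Gram determinant: half of its logarithmic derivative pairs
  the edge velocities with the dual basis.\<close>

lemma triangle_area_rate:
  fixes q :: "nat \<Rightarrow> real \<Rightarrow> 'n::euclidean_space"
  assumes nc: "\<And>s. s \<in> I \<Longrightarrow> \<not> collinear {0, q j s - q i s, q k s - q i s}"
    and q: "\<And>l s. l \<in> {i, j, k} \<Longrightarrow> s \<in> I \<Longrightarrow> (q l has_vector_derivative r l s) (at s within I)"
  shows "\<exists>A. (\<forall>s\<in>I. A s \<ge> 0 \<and>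
        hausdorff_outer 2 (rel_interior (convex hull {q i s, q j s, q k s})) = ennreal (A s) \<and>
        hausdorff_outer 2 (convex hull {q i s, q j s, q k s} - rel_interior (convex hull {q i s, q j s, q k s})) = 0) \<and>
      (\<forall>t\<in>I. \<exists>d1 d2. d1 \<in> span {q j t - q i t, q k t - q i t} \<and> d2 \<in> span {q j t - q i t, q k t - q i t} \<and>
        d1 \<bullet> (q j t - q i t) = 1 \<and> d1 \<bullet> (q k t - q i t) = 0 \<and>
        d2 \<bullet> (q j t - q i t) = 0 \<and> d2 \<bullet> (q k t - q i t) = 1 \<and>
        (A has_real_derivative A t * (d1 \<bullet> (r j t - r i t) + d2 \<bullet> (r k t - r i t))) (at t within I))"
proof -
  obtain c where c: "c \<ge> 0" and H: "\<forall>a b d :: 'n. \<not> collinear {0, b - a, d - a} \<longrightarrow>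
     hausdorff_outer 2 (rel_interior (convex hull {a, b, d})) = ennreal (c * parallelogram_area (b - a) (d - a)) \<and>
     hausdorff_outer 2 (convex hull {a, b, d} - rel_interior (convex hull {a, b, d})) = 0"
    using hausdorff_outer_triangle[where 'n = 'n] by blast
  define w1 where "w1 s = q j s - q i s" for s
  define w2 where "w2 s = q k s - q i s" for s
  define G where "G s = (w1 s \<bullet> w1 s) * (w2 s \<bullet> w2 s) - (w1 s \<bullet> w2 s) * (w1 s \<bullet> w2 s)" for s
  have G: "G s > 0" if "s \<in> I" for s
    using not_collinear_gram_pos[OF nc[OF that]] by (simp add: G_def w1_def w2_def power2_eq_square)
  define A where "A s = c * sqrt (G s)" for s
  have A_par: "A s = c * parallelogram_area (q j s - q i s) (q k s - q i s)" for s
    by (simp add: A_def G_def w1_def w2_def parallelogram_area_def power2_eq_square)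
  have "\<exists>d1 d2. d1 \<in> span {w1 t, w2 t} \<and> d2 \<in> span {w1 t, w2 t} \<and>
        d1 \<bullet> w1 t = 1 \<and> d1 \<bullet> w2 t = 0 \<and> d2 \<bullet> w1 t = 0 \<and> d2 \<bullet> w2 t = 1 \<and>
        (A has_real_derivative A t * (d1 \<bullet> (r j t - r i t) + d2 \<bullet> (r k t - r i t))) (at t within I)"
    if t: "t \<in> I" for t
  proof -
    define v1 where "v1 = r j t - r i t"
    define v2 where "v2 = r k t - r i t"
    \<comment> \<open>Cramer's rule: the inverse Gram matrix applied to the edges.\<close>
    define d1 where "d1 = ((w2 t \<bullet> w2 t) *\<^sub>R w1 t - (w1 t \<bullet> w2 t) *\<^sub>R w2 t) /\<^sub>R G t"
    define d2 where "d2 = ((w1 t \<bullet> w1 t) *\<^sub>R w2 t - (w1 t \<bullet> w2 t) *\<^sub>R w1 t) /\<^sub>R G t"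
    have w1: "(w1 has_vector_derivative v1) (at t within I)"
      unfolding w1_def v1_def using t by (auto intro!: derivative_intros q)
    have w2: "(w2 has_vector_derivative v2) (at t within I)"
      unfolding w2_def v2_def using t by (auto intro!: derivative_intros q)
    define G' where "G' = 2 * ((w2 t \<bullet> w2 t) * (w1 t \<bullet> v1) + (w1 t \<bullet> w1 t) * (w2 t \<bullet> v2)
        - (w1 t \<bullet> w2 t) * (w2 t \<bullet> v1 + w1 t \<bullet> v2))"
    have "(G has_real_derivative G') (at t within I)"
      unfolding G_def G'_def
      by (rule derivative_eq_intros has_real_derivative_inner[OF w1 w1] has_real_derivative_inner[OF w2 w2]
            has_real_derivative_inner[OF w1 w2] refl)+
        (simp add: algebra_simps inner_commute)
    from has_real_derivative_mult_sqrt[OF this G[OF t], of c]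
    have "(A has_real_derivative A t * (G' / (2 * G t))) (at t within I)"
      by (simp add: A_def[abs_def])
    moreover have "G' / (2 * G t) = d1 \<bullet> v1 + d2 \<bullet> v2"
      using G[OF t] by (simp add: G'_def d1_def d2_def inner_diff_left field_simps)
    moreover have "d1 \<bullet> w1 t = 1" "d1 \<bullet> w2 t = 0" "d2 \<bullet> w1 t = 0" "d2 \<bullet> w2 t = 1"
      using G[OF t] by (simp_all add: d1_def d2_def inner_diff_left field_simps)
        (simp_all add: G_def inner_commute)
    moreover have "d1 \<in> span {w1 t, w2 t}" "d2 \<in> span {w1 t, w2 t}"
      unfolding d1_def d2_def by (intro span_scale span_diff; simp add: span_base)+
    ultimately show ?thesis by (intro exI[of _ d1] exI[of _ d2]) (simp add: v1_def v2_def)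
  qed
  moreover have "A s \<ge> 0" if "s \<in> I" for s
    using c G[OF that] by (simp add: A_def)
  ultimately show ?thesis
    using H nc by (intro exI[of _ A]) (auto simp: A_par w1_def w2_def)
qed

text \<open>Hides the dimension and the dual basis from the global argument. The rate
  \<open>g\<close> is chosen before the surface, the field and the point, so one number serves as
  growth rate of the area and as value of the integrand on the whole simplex.\<close>

lemma simplex_area_rate:
  fixes q :: "nat \<Rightarrow> real \<Rightarrow> real^'n"
  defines "K \<equiv> \<lambda>J s. convex hull ((\<lambda>k. q k s) ` J)"
  assumes dim: "CARD('n) \<in> {2, 3}" and J: "card J = CARD('n)"
    and inj: "\<And>s. s \<in> I \<Longrightarrow> inj_on (\<lambda>k. q k s) J"
    and indep: "\<And>s. s \<in> I \<Longrightarrow> \<not> affine_dependent ((\<lambda>k. q k s) ` J)"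
    and q: "\<And>k s. k \<in> J \<Longrightarrow> s \<in> I \<Longrightarrow> (q k has_vector_derivative r k s) (at s within I)"
  shows "\<exists>A. (\<forall>s\<in>I. A s \<ge> 0 \<and> hausdorff_outer (CARD('n) - 1) (rel_interior (K J s)) = ennreal (A s) \<and>
        hausdorff_outer (CARD('n) - 1) (K J s - rel_interior (K J s)) = 0) \<and>
      (\<forall>t\<in>I. \<exists>g. (A has_real_derivative A t * g) (at t within I) \<and>
        (\<forall>S X \<eta> x. disjoint S \<longrightarrow> rel_interior (K J t) \<in> S \<longrightarrow> x \<in> rel_interior (K J t) \<longrightarrow>
           (\<forall>y\<in>surface S. X y = y) \<longrightarrow> \<eta> \<in> V_space S \<longrightarrow> (\<forall>k\<in>J. \<eta> (q k t) = r k t) \<longrightarrow>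
           surface_grad_vec S X x \<bullet> surface_grad_vec S \<eta> x = g))"
proof -
  have fin: "finite J" using J by (metis card.infinite zero_less_card_finite less_irrefl)
  have inner: "surface_grad_vec S X x \<bullet> surface_grad_vec S \<eta> x = (\<Sum>j\<in>J - {i}. d j \<bullet> (r j t - r i t))"
    if "disjoint S" "rel_interior (K J t) \<in> S" "x \<in> rel_interior (K J t)" "\<forall>y\<in>surface S. X y = y"
      "\<eta> \<in> V_space S" "\<forall>k\<in>J. \<eta> (q k t) = r k t" "i \<in> J"
      "\<And>j. j \<in> J - {i} \<Longrightarrow> d j \<in> span ((\<lambda>j. q j t - q i t) ` J)"
      "\<And>l j. l \<in> J - {i} \<Longrightarrow> j \<in> J - {i} \<Longrightarrow> d l \<bullet> (q j t - q i t) = (if l = j then 1 else 0)"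
    for S X \<eta> x i d t
    using that fin
    by (intro surface_grad_vec_identity_inner[where \<sigma> = "rel_interior (K J t)" and p = "\<lambda>k. q k t"])
      (auto simp: K_def)
  consider "CARD('n) = 2" | "CARD('n) = 3" using dim by blast
  then show ?thesis
  proof cases
    case 1
    then obtain i j where ij: "J = {i, j}" "i \<noteq> j"
      using J by (metis card_2_iff)
    have "\<exists>A. (\<forall>s\<in>I. A s \<ge> 0 \<and>
        hausdorff_outer 1 (rel_interior (convex hull {q i s, q j s})) = ennreal (A s) \<and>
        hausdorff_outer 1 (convex hull {q i s, q j s} - rel_interior (convex hull {q i s, q j s})) = 0) \<and>
      (\<forall>t\<in>I. \<exists>d. d \<in> span {q j t - q i t} \<and> d \<bullet> (q j t - q i t) = 1 \<and>
        (A has_real_derivative A t * (d \<bullet> (r j t - r i t))) (at t within I))"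
      using inj ij q by (intro segment_area_rate) (auto dest: inj_onD)
    then obtain A where A: "\<forall>s\<in>I. A s \<ge> 0 \<and>
        hausdorff_outer 1 (rel_interior (convex hull {q i s, q j s})) = ennreal (A s) \<and>
        hausdorff_outer 1 (convex hull {q i s, q j s} - rel_interior (convex hull {q i s, q j s})) = 0"
      and dA: "\<forall>t\<in>I. \<exists>d. d \<in> span {q j t - q i t} \<and> d \<bullet> (q j t - q i t) = 1 \<and>
        (A has_real_derivative A t * (d \<bullet> (r j t - r i t))) (at t within I)"
      by blast
    show ?thesis
    proof (intro exI[of _ A] conjI ballI)
      fix t assume "t \<in> I"
      then obtain d where d: "d \<in> span {q j t - q i t}" "d \<bullet> (q j t - q i t) = 1"
          "(A has_real_derivative A t * (d \<bullet> (r j t - r i t))) (at t within I)"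
        using dA by blast
      have "surface_grad_vec S X x \<bullet> surface_grad_vec S \<eta> x = d \<bullet> (r j t - r i t)"
        if "disjoint S" "rel_interior (K J t) \<in> S" "x \<in> rel_interior (K J t)" "\<forall>y\<in>surface S. X y = y"
          "\<eta> \<in> V_space S" "\<forall>k\<in>J. \<eta> (q k t) = r k t" for S X \<eta> x
        using inner[OF that, of i "\<lambda>_. d"] ij d(1,2) by auto
      then show "\<exists>g. (A has_real_derivative A t * g) (at t within I) \<and>
        (\<forall>S X \<eta> x. disjoint S \<longrightarrow> rel_interior (K J t) \<in> S \<longrightarrow> x \<in> rel_interior (K J t) \<longrightarrow>
           (\<forall>y\<in>surface S. X y = y) \<longrightarrow> \<eta> \<in> V_space S \<longrightarrow> (\<forall>k\<in>J. \<eta> (q k t) = r k t) \<longrightarrow>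
           surface_grad_vec S X x \<bullet> surface_grad_vec S \<eta> x = g)"
        using d(3) by blast
    qed (use A 1 in \<open>simp_all add: K_def ij\<close>)
  next
    case 2
    then obtain i j k where ij: "J = {i, j, k}" "i \<noteq> j" "i \<noteq> k" "j \<noteq> k"
      using J by (metis card_3_iff)
    have nc: "\<not> collinear {0, q j s - q i s, q k s - q i s}" if "s \<in> I" for s
    proof -
      have "\<not> collinear {q j s, q i s, q k s}"
        using indep[OF that] inj[OF that] ij
        by (auto simp: collinear_3_eq_affine_dependent insert_commute dest: inj_onD)
      then show ?thesis
        by (auto simp: collinear_def)
    qed
    obtain A where A: "\<forall>s\<in>I. A s \<ge> 0 \<and>
        hausdorff_outer 2 (rel_interior (convex hull {q i s, q j s, q k s})) = ennreal (A s) \<and>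
        hausdorff_outer 2 (convex hull {q i s, q j s, q k s} - rel_interior (convex hull {q i s, q j s, q k s})) = 0"
      and dA: "\<forall>t\<in>I. \<exists>d1 d2. d1 \<in> span {q j t - q i t, q k t - q i t} \<and> d2 \<in> span {q j t - q i t, q k t - q i t} \<and>
        d1 \<bullet> (q j t - q i t) = 1 \<and> d1 \<bullet> (q k t - q i t) = 0 \<and>
        d2 \<bullet> (q j t - q i t) = 0 \<and> d2 \<bullet> (q k t - q i t) = 1 \<and>
        (A has_real_derivative A t * (d1 \<bullet> (r j t - r i t) + d2 \<bullet> (r k t - r i t))) (at t within I)"
      using triangle_area_rate[of I q j i k r, OF nc] q ij(1) by blast
    show ?thesis
    proof (intro exI[of _ A] conjI ballI)
      fix t assume "t \<in> I"
      then obtain d1 d2 where d: "d1 \<in> span {q j t - q i t, q k t - q i t}" "d2 \<in> span {q j t - q i t, q k t - q i t}"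
          "d1 \<bullet> (q j t - q i t) = 1" "d1 \<bullet> (q k t - q i t) = 0"
          "d2 \<bullet> (q j t - q i t) = 0" "d2 \<bullet> (q k t - q i t) = 1"
          "(A has_real_derivative A t * (d1 \<bullet> (r j t - r i t) + d2 \<bullet> (r k t - r i t))) (at t within I)"
        using dA by blast
      have "surface_grad_vec S X x \<bullet> surface_grad_vec S \<eta> x = d1 \<bullet> (r j t - r i t) + d2 \<bullet> (r k t - r i t)"
        if "disjoint S" "rel_interior (K J t) \<in> S" "x \<in> rel_interior (K J t)" "\<forall>y\<in>surface S. X y = y"
          "\<eta> \<in> V_space S" "\<forall>k\<in>J. \<eta> (q k t) = r k t" for S X \<eta> x
      proof -
        define d where "d l = (if l = j then d1 else d2)" for l
        have Ji: "J - {i} = {j, k}" using ij by auto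
        have "surface_grad_vec S X x \<bullet> surface_grad_vec S \<eta> x = (\<Sum>l\<in>J - {i}. d l \<bullet> (r l t - r i t))"
        proof (rule inner[OF that])
          show "i \<in> J" using ij by simp
        next
          fix l assume "l \<in> J - {i}"
          then show "d l \<in> span ((\<lambda>j. q j t - q i t) ` J)"
            using d(1,2) ij by (auto simp: d_def intro: span_mono[THEN subsetD, rotated])
        next
          fix l m assume "l \<in> J - {i}" "m \<in> J - {i}"
          then show "d l \<bullet> (q m t - q i t) = (if l = m then 1 else 0)"
            unfolding Ji using d(3-6) ij(4) by (auto simp: d_def)
        qed
        then show ?thesis unfolding Ji using ij(4) by (simp add: d_def)
      qed
      then show "\<exists>g. (A has_real_derivative A t * g) (at t within I) \<and>
        (\<forall>S X \<eta> x. disjoint S \<longrightarrow> rel_interior (K J t) \<in> S \<longrightarrow> x \<in> rel_interior (K J t) \<longrightarrow>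
           (\<forall>y\<in>surface S. X y = y) \<longrightarrow> \<eta> \<in> V_space S \<longrightarrow> (\<forall>k\<in>J. \<eta> (q k t) = r k t) \<longrightarrow>
           surface_grad_vec S X x \<bullet> surface_grad_vec S \<eta> x = g)"
        using d(7) by blast
    qed (use A 2 in \<open>simp_all add: K_def ij(1)\<close>)
  qed
qed

subsection \<open>Integrals over a polyhedral surface\<close>

lemma null_sets_hausdorff_subset:
  assumes "N \<in> null_sets (hausdorff_measure m)" "A \<subseteq> N"
  shows "A \<in> null_sets (hausdorff_measure m)"
proof (rule hausdorff_outer_0_null_sets)
  have "hausdorff_outer m N = 0"
    using assms(1) by (simp add: null_sets_def emeasure_hausdorff_measure[symmetric])
  then show "hausdorff_outer m A = 0"
    using hausdorff_outer_mono[OF assms(2), of m] by simp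
qed

text \<open>\<open>F\<close> is arbitrary, since the surface gradient is uncontrolled on the edges.
  Every preimage is a subset of \<open>N\<close> or the complement of one, hence measurable by
  completeness.\<close>

lemma has_bochner_integral_hausdorff_null:
  fixes F :: "'a::metric_space \<Rightarrow> real"
  assumes "N \<in> null_sets (hausdorff_measure m)"
  shows "has_bochner_integral (hausdorff_measure m) (\<lambda>x. indicator N x * F x) 0"
proof -
  let ?M = "hausdorff_measure m :: 'a measure"
  let ?f = "\<lambda>x. indicator N x * F x"
  have sub: "A \<in> sets ?M" if "A \<subseteq> N" for A
    using null_sets_hausdorff_subset[OF assms that] by blast
  have "?f \<in> borel_measurable ?M"
  proof (rule measurableI)
    fix B :: "real set" assume "B \<in> sets borel"
    have *: "?f -` B = (if 0 \<in> B then UNIV - (N \<inter> F -` (- B)) else N \<inter> F -` B)"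
    proof (rule set_eqI)
      fix x show "x \<in> ?f -` B \<longleftrightarrow> x \<in> (if 0 \<in> B then UNIV - (N \<inter> F -` (- B)) else N \<inter> F -` B)"
        by (cases "x \<in> N") auto
    qed
    have "UNIV - (N \<inter> F -` (- B)) \<in> sets ?M"
      using sets.compl_sets[OF sub[of "N \<inter> F -` (- B)"]] by simp
    then show "?f -` B \<inter> space ?M \<in> sets ?M"
      unfolding * using sub[of "N \<inter> F -` B"] by simp
  qed auto
  moreover have "AE x in ?M. ?f x = 0"
    using AE_not_in[OF assms] by eventually_elim simp
  ultimately show ?thesis
    using has_bochner_integral_zero[of ?M] has_bochner_integral_cong_AE[of ?f ?M "\<lambda>_. 0" 0] by simp
qed

text \<open>By disjointness exactly one summand survives at a point of an open simplex. All other
  points of the surface lie in \<open>Z\<close>, inside the finite union of the null sets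
  \<open>closure \<sigma> - \<sigma>\<close>.\<close>

lemma set_integral_piecewise_constant:
  fixes F :: "real^'n \<Rightarrow> real"
  assumes "finite S" "disjoint S"
    and S: "\<And>\<sigma>. \<sigma> \<in> S \<Longrightarrow> \<sigma> \<in> sets (hausdorff_measure m)"
      "\<And>\<sigma>. \<sigma> \<in> S \<Longrightarrow> emeasure (hausdorff_measure m) \<sigma> < \<infinity>"
      "\<And>\<sigma>. \<sigma> \<in> S \<Longrightarrow> closure \<sigma> - \<sigma> \<in> null_sets (hausdorff_measure m)"
    and F: "\<And>\<sigma> x. \<sigma> \<in> S \<Longrightarrow> x \<in> \<sigma> \<Longrightarrow> F x = h \<sigma>"
  shows "(LINT x:surface S|hausdorff_measure m. F x) = (\<Sum>\<sigma>\<in>S. measure (hausdorff_measure m) \<sigma> * h \<sigma>)"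
proof -
  let ?M = "hausdorff_measure m :: (real^'n) measure"
  define Z where "Z = surface S - \<Union>S"
  have "(\<Union>\<sigma>\<in>S. closure \<sigma> - \<sigma>) \<in> null_sets ?M"
    using \<open>finite S\<close> S(3) by (intro null_sets.finite_UN) auto
  then have Z: "Z \<in> null_sets ?M"
    by (rule null_sets_hausdorff_subset) (auto simp: Z_def surface_def)
  have pt: "indicator (surface S) x * F x = (\<Sum>\<sigma>\<in>S. indicator \<sigma> x * h \<sigma>) + indicator Z x * F x" for x
  proof (cases "x \<in> \<Union>S")
    case True
    then obtain \<tau> where \<tau>: "\<tau> \<in> S" "x \<in> \<tau>" by blast
    have "(\<Sum>\<sigma>\<in>S. indicator \<sigma> x * h \<sigma>) = (\<Sum>\<sigma>\<in>{\<tau>}. indicator \<sigma> x * h \<sigma>)"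
      using \<open>finite S\<close> \<tau> \<open>disjoint S\<close>
      by (intro sum.mono_neutral_right) (auto simp: disjoint_def indicator_def)
    moreover have "x \<in> surface S"
      using \<tau> closure_subset by (auto simp: surface_def)
    moreover have "x \<notin> Z" using True by (simp add: Z_def)
    ultimately show ?thesis
      using F[OF \<tau>] \<tau> by simp
  next
    case False
    then have "(\<Sum>\<sigma>\<in>S. indicator \<sigma> x * h \<sigma>) = 0"
      by (intro sum.neutral) (auto simp: indicator_def)
    then show ?thesis using False by (simp add: Z_def indicator_def)
  qed
  have "has_bochner_integral ?M (\<lambda>x. (\<Sum>\<sigma>\<in>S. indicator \<sigma> x * h \<sigma>) + indicator Z x * F x)
      ((\<Sum>\<sigma>\<in>S. measure ?M \<sigma> * h \<sigma>) + 0)"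
    using S(1,2)
    by (intro has_bochner_integral_add has_bochner_integral_sum has_bochner_integral_hausdorff_null Z
        has_bochner_integral_mult_left has_bochner_integral_real_indicator) auto
  then have "has_bochner_integral ?M (\<lambda>x. indicator (surface S) x * F x) (\<Sum>\<sigma>\<in>S. measure ?M \<sigma> * h \<sigma>)"
    unfolding pt by simp
  then show ?thesis
    by (simp add: set_lebesgue_integral_def has_bochner_integral_integral_eq)
qed

lemma measure_surface:
  fixes S :: "(real^'n) set set"
  assumes "finite S" "disjoint S"
    and S: "\<And>\<sigma>. \<sigma> \<in> S \<Longrightarrow> \<sigma> \<in> sets (hausdorff_measure m)"
      "\<And>\<sigma>. \<sigma> \<in> S \<Longrightarrow> emeasure (hausdorff_measure m) \<sigma> < \<infinity>"
      "\<And>\<sigma>. \<sigma> \<in> S \<Longrightarrow> closure \<sigma> - \<sigma> \<in> null_sets (hausdorff_measure m)"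
  shows "measure (hausdorff_measure m) (surface S) = (\<Sum>\<sigma>\<in>S. measure (hausdorff_measure m) \<sigma>)"
  using set_integral_piecewise_constant[OF assms, of "\<lambda>_. 1" "\<lambda>_. 1"]
  by (simp add: set_lebesgue_integral_def)

text \<open>The closure of an open simplex returns its hull, the extreme points return the vertices,
  and injectivity of \<open>p\<close> returns the index set. This permits sums over simplices to be
  rewritten as sums over the connectivity.\<close>

lemma inj_on_rel_interior_convex_hull:
  fixes p :: "'i \<Rightarrow> 'a::euclidean_space"
  assumes "inj_on p (\<Union>C)" and indep: "\<And>J. J \<in> C \<Longrightarrow> \<not> affine_dependent (p ` J)"
  shows "inj_on (\<lambda>J. rel_interior (convex hull (p ` J))) C"
proof (rule inj_onI)
  fix J J' assume J: "J \<in> C" "J' \<in> C"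
    and eq: "rel_interior (convex hull (p ` J)) = rel_interior (convex hull (p ` J'))"
  have cl: "closure (rel_interior (convex hull (p ` J))) = convex hull (p ` J)" if "J \<in> C" for J
    using aff_independent_finite[OF indep[OF that]]
    by (simp add: convex_closure_rel_interior finite_imp_compact_convex_hull compact_imp_closed)
  have "convex hull (p ` J) = convex hull (p ` J')"
    using arg_cong[OF eq, of closure] by (simp add: cl J)
  then have "p ` J = p ` J'"
    using extreme_point_of_convex_hull_affine_independent[OF indep[OF J(1)]]
      extreme_point_of_convex_hull_affine_independent[OF indep[OF J(2)]] by auto
  then show "J = J'"
    using inj_on_image_eq_iff[OF assms(1), of J J'] J by auto
qed

text \<open>The set of simplices changes with time but the connectivity does not. Area and integral
  are both rewritten as finite sums over \<open>C\<close>, and then compared term by term.\<close>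

lemma surface_area_derivative:
  fixes q :: "nat \<Rightarrow> real \<Rightarrow> real^'n"
  assumes dim: "CARD('n) \<in> {2, 3}" and surf: "evolving_polyhedral_surface T C q S"
    and t: "t \<in> {0..T}" and X: "\<And>x. x \<in> surface (S t) \<Longrightarrow> X x = x"
    and Xt: "Xt \<in> V_space (S t)" "\<And>k. k \<in> \<Union>C \<Longrightarrow> Xt (q k t) = vector_derivative (q k) (at t within {0..T})"
  shows "((\<lambda>s. surface_area (surface (S s))) has_real_derivative
      surface_inner (S t) (surface_grad_vec (S t) X) (surface_grad_vec (S t) Xt)) (at t within {0..T})"
proof -
  let ?I = "{0..T}"
  let ?M = "hausdorff_measure (CARD('n) - 1) :: (real^'n) measure"
  define r where "r k s = vector_derivative (q k) (at s within ?I)" for k s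
  define K where "K J s = convex hull ((\<lambda>k. q k s) ` J)" for J s
  note surf_C = surf[unfolded evolving_polyhedral_surface_def, THEN conjunct1]
    surf[unfolded evolving_polyhedral_surface_def, THEN conjunct2, THEN conjunct1]
  note surf_I = bspec[OF surf[unfolded evolving_polyhedral_surface_def, THEN conjunct2, THEN conjunct2]]
  have C: "finite C" "\<And>J. J \<in> C \<Longrightarrow> card J = CARD('n)"
    using surf_C by simp_all
  have S: "S s = (\<lambda>J. rel_interior (K J s)) ` C"
    and inj: "inj_on (\<lambda>k. q k s) (\<Union>C)"
    and indep: "\<And>J. J \<in> C \<Longrightarrow> \<not> affine_dependent ((\<lambda>k. q k s) ` J)"
    and closed: "closed_polyhedral_surface (S s)"
    and q: "\<And>k. k \<in> \<Union>C \<Longrightarrow> (q k has_vector_derivative r k s) (at s within ?I)" if "s \<in> ?I" for s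
  proof -
    note facts = surf_I[OF that]
    show "S s = (\<lambda>J. rel_interior (K J s)) ` C"
      unfolding K_def using facts by (rule conjunct1)
    show "inj_on (\<lambda>k. q k s) (\<Union>C)" "closed_polyhedral_surface (S s)"
      using facts by blast+
    show "\<not> affine_dependent ((\<lambda>k. q k s) ` J)" if "J \<in> C" for J
      using facts that by simp
    show "(q k has_vector_derivative r k s) (at s within ?I)" if "k \<in> \<Union>C" for k
      using facts that unfolding r_def vector_derivative_works[symmetric] by blast
  qed
  have disj: "disjoint (S s)" if "s \<in> ?I" for s
    using closed[OF that] by (simp add: closed_polyhedral_surface_def)
  have injK: "inj_on (\<lambda>J. rel_interior (K J s)) C" if "s \<in> ?I" for s
    unfolding K_def using inj_on_rel_interior_convex_hull[OF inj[OF that] indep[OF that]] .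
  define AP where "AP J A \<longleftrightarrow> (\<forall>s\<in>?I. A s \<ge> 0 \<and>
      hausdorff_outer (CARD('n) - 1) (rel_interior (K J s)) = ennreal (A s) \<and>
      hausdorff_outer (CARD('n) - 1) (K J s - rel_interior (K J s)) = 0)" for J A
  define GP where "GP J A t g \<longleftrightarrow> (A has_real_derivative A t * g) (at t within ?I) \<and>
      (\<forall>S X \<eta> x. disjoint S \<longrightarrow> rel_interior (K J t) \<in> S \<longrightarrow> x \<in> rel_interior (K J t) \<longrightarrow>
         (\<forall>y\<in>surface S. X y = y) \<longrightarrow> \<eta> \<in> V_space S \<longrightarrow> (\<forall>k\<in>J. \<eta> (q k t) = r k t) \<longrightarrow>
         surface_grad_vec S X x \<bullet> surface_grad_vec S \<eta> x = g)" for J A t g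
  have "\<exists>A. AP J A \<and> (\<forall>t\<in>?I. \<exists>g. GP J A t g)" if "J \<in> C" for J
    unfolding AP_def GP_def K_def
  proof (rule simplex_area_rate[OF dim C(2)[OF that]])
    show "inj_on (\<lambda>k. q k s) J" if "s \<in> ?I" for s
      using inj_on_subset[OF inj[OF that]] \<open>J \<in> C\<close> by blast
  qed (use that indep q in blast)+
  then obtain A where AP: "\<And>J. J \<in> C \<Longrightarrow> AP J (A J)"
      and GP: "\<And>J. J \<in> C \<Longrightarrow> \<exists>g. GP J (A J) t g"
    using t by metis
  have A: "A J s \<ge> 0"
      "hausdorff_outer (CARD('n) - 1) (rel_interior (K J s)) = ennreal (A J s)"
      "hausdorff_outer (CARD('n) - 1) (K J s - rel_interior (K J s)) = 0" if "J \<in> C" "s \<in> ?I" for J s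
    using AP[OF that(1)] that(2) unfolding AP_def by blast+
  obtain g where g: "\<And>J. J \<in> C \<Longrightarrow> (A J has_real_derivative A J t * g J) (at t within ?I)"
      "\<And>J x. J \<in> C \<Longrightarrow> x \<in> rel_interior (K J t) \<Longrightarrow>
        surface_grad_vec (S t) X x \<bullet> surface_grad_vec (S t) Xt x = g J"
  proof -
    have "\<exists>g. (A J has_real_derivative A J t * g) (at t within ?I) \<and>
        (\<forall>x \<in> rel_interior (K J t). surface_grad_vec (S t) X x \<bullet> surface_grad_vec (S t) Xt x = g)"
      if J: "J \<in> C" for J
    proof -
      have 1: "rel_interior (K J t) \<in> S t" using S[OF t] J by blast
      have 2: "\<forall>k\<in>J. Xt (q k t) = r k t" using Xt(2) J by (auto simp: r_def)
      obtain g where "GP J (A J) t g" using GP[OF J] by blast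
      then show ?thesis unfolding GP_def using disj[OF t] 1 2 X Xt(1) by blast
    qed
    then show ?thesis using that by metis
  qed
  have meas: "\<sigma> \<in> sets ?M" if "s \<in> ?I" "\<sigma> \<in> S s" for s \<sigma>
    using that S by (auto intro: rel_interior_in_borel)
  have area: "emeasure ?M (rel_interior (K J s)) = ennreal (A J s)" if "J \<in> C" "s \<in> ?I" for J s
    using A(2)[OF that] by (simp add: emeasure_hausdorff_measure borel_in_sets_hausdorff rel_interior_in_borel)
  then have area': "measure ?M (rel_interior (K J s)) = A J s" if "J \<in> C" "s \<in> ?I" for J s
    using A(1)[OF that] that by (simp add: measure_def)
  have fin: "emeasure ?M \<sigma> < \<infinity>" if "s \<in> ?I" "\<sigma> \<in> S s" for s \<sigma>
    using that S area by auto
  have null: "closure \<sigma> - \<sigma> \<in> null_sets ?M" if s: "s \<in> ?I" "\<sigma> \<in> S s" for s \<sigma>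
  proof -
    obtain J where J: "J \<in> C" "\<sigma> = rel_interior (K J s)" using s S by blast
    have "closure \<sigma> = K J s"
      using aff_independent_finite[OF indep[OF s(1) J(1)]] unfolding J(2) K_def
      by (simp add: convex_closure_rel_interior finite_imp_compact_convex_hull compact_imp_closed)
    then show ?thesis
      using A(3)[OF J(1) s(1)] J(2) by (auto intro: hausdorff_outer_0_null_sets)
  qed
  have finS: "finite (S s)" if "s \<in> ?I" for s
    using S[OF that] C(1) by simp
  have total: "surface_area (surface (S s)) = (\<Sum>J\<in>C. A J s)" if s: "s \<in> ?I" for s
  proof -
    have "surface_area (surface (S s)) = (\<Sum>\<sigma>\<in>S s. measure ?M \<sigma>)"
      unfolding surface_area_def
      by (rule measure_surface[OF finS[OF s] disj[OF s] meas[OF s] fin[OF s] null[OF s]])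
    also have "\<dots> = (\<Sum>J\<in>C. measure ?M (rel_interior (K J s)))"
      unfolding S[OF s] by (rule sum.reindex[OF injK[OF s], unfolded comp_def])
    also have "\<dots> = (\<Sum>J\<in>C. A J s)"
      using area' s by (intro sum.cong) auto
    finally show ?thesis .
  qed
  have "surface_inner (S t) (surface_grad_vec (S t) X) (surface_grad_vec (S t) Xt) = (\<Sum>J\<in>C. A J t * g J)"
  proof -
    \<comment> \<open>The integrand is indexed by simplices, the rates by index sets;
      \<open>injK\<close> makes the translation well defined.\<close>
    define h where "h \<sigma> = g (inv_into C (\<lambda>J. rel_interior (K J t)) \<sigma>)" for \<sigma>
    have h: "h (rel_interior (K J t)) = g J" if "J \<in> C" for J
      unfolding h_def using inv_into_f_f[OF injK[OF t] that] by simp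
    have F: "surface_grad_vec (S t) X x \<bullet> surface_grad_vec (S t) Xt x = h \<sigma>"
      if "\<sigma> \<in> S t" "x \<in> \<sigma>" for \<sigma> x
      using that g(2) h S[OF t] by auto
    have "surface_inner (S t) (surface_grad_vec (S t) X) (surface_grad_vec (S t) Xt)
        = (\<Sum>\<sigma>\<in>S t. measure ?M \<sigma> * h \<sigma>)"
      unfolding surface_inner_def
      by (rule set_integral_piecewise_constant[OF finS[OF t] disj[OF t] meas[OF t] fin[OF t] null[OF t] F])
    also have "\<dots> = (\<Sum>J\<in>C. measure ?M (rel_interior (K J t)) * h (rel_interior (K J t)))"
      unfolding S[OF t] by (rule sum.reindex[OF injK[OF t], unfolded comp_def])
    also have "\<dots> = (\<Sum>J\<in>C. A J t * g J)"
      using area' t h by (intro sum.cong) auto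
    finally show ?thesis .
  qed
  moreover have "((\<lambda>s. \<Sum>J\<in>C. A J s) has_real_derivative (\<Sum>J\<in>C. A J t * g J)) (at t within ?I)"
    by (intro DERIV_sum g)
  \<comment> \<open>The area formula holds on \<open>{0..T}\<close>, which suffices for the
    derivative within that interval; at \<open>T\<close> it is one-sided.\<close>
  ultimately show ?thesis
    using total t by (auto intro: has_field_derivative_transform_within[OF _ zero_less_one])
qed

section \<open>Symmetry of the inner products and the weighted norm\<close>

lemma lumped_inner_commute: "lumped_inner S v w = lumped_inner S w v"
  by (simp add: lumped_inner_def inner_commute)

lemma surface_inner_commute: "surface_inner S v w = surface_inner S w v"
  by (simp add: surface_inner_def inner_commute)

lemma L2_inner_commute: "L2_inner \<Omega> u v = L2_inner \<Omega> v u"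
  by (simp add: L2_inner_def inner_commute)

text \<open>Both sides integrate the same function, so the identity persists without integrability,
  where both integrals take the default value 0.\<close>

lemma L2_nrm_sqrt_weight:
  assumes "\<And>x. m x \<ge> 0"
  shows "(L2_nrm \<Omega> (\<lambda>x. sqrt (m x) *\<^sub>R u x))\<^sup>2 = L2_inner \<Omega> (\<lambda>x. m x *\<^sub>R u x) u"
proof -
  have "(norm (sqrt (m x) *\<^sub>R u x))\<^sup>2 = (m x *\<^sub>R u x) \<bullet> u x" for x
    using assms[of x] by (simp add: power_mult_distrib power2_norm_eq_inner)
  moreover have "(\<integral>x. (norm (sqrt (m x) *\<^sub>R u x))\<^sup>2 \<partial>lebesgue_on \<Omega>) \<ge> 0"
    by (rule integral_nonneg_AE) simp
  ultimately show ?thesis by (simp add: L2_nrm_def L2_inner_def)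
qed

subsection \<open>The energy law\<close>

theorem mainTheorem3:
  fixes \<Omega> :: "(real^'n) set"
    and T \<gamma> \<mu>m \<mu>p :: real
    and \<T>h :: "real \<Rightarrow> (real^'n) set set"
    and Uh :: "real \<Rightarrow> (real^'n \<Rightarrow> real^'n) set"
    and Ph :: "real \<Rightarrow> (real^'n \<Rightarrow> real) set"
    and C :: "nat set set"
    and q :: "nat \<Rightarrow> real \<Rightarrow> real^'n"
    and S :: "real \<Rightarrow> (real^'n) set set"
    and \<nu> f fh U X Xt :: "real \<Rightarrow> real^'n \<Rightarrow> real^'n"
    and P \<kappa> \<mu> :: "real \<Rightarrow> real^'n \<Rightarrow> real"
  assumes dim: "CARD('n) \<in> {2, 3}"
    and domain: "polyhedral_domain \<Omega>"
    and pos: "T > 0" "\<gamma> > 0" "\<mu>m > 0" "\<mu>p > 0"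
    and mesh: "\<And>t. t \<in> {0..T} \<Longrightarrow> regular_partitioning \<Omega> (\<T>h t)"
    and vel_space: "\<And>t. t \<in> {0..T} \<Longrightarrow> velocity_space \<Omega> (\<T>h t) (Uh t)"
    and pres_space: "\<And>t. t \<in> {0..T} \<Longrightarrow> pressure_space \<Omega> (\<T>h t) (Ph t)"
    and surf: "evolving_polyhedral_surface T C q S"
    and surf_in: "\<And>t. t \<in> {0..T} \<Longrightarrow> surface (S t) \<subseteq> closure \<Omega>"
    and normal: "\<And>t. t \<in> {0..T} \<Longrightarrow> outer_unit_normal (S t) (\<nu> t)"
    and visc: "\<And>t. t \<in> {0..T} \<Longrightarrow> \<mu> t = bulk_viscosity \<Omega> (\<T>h t) (S t) \<mu>m \<mu>p"
    and forcing: "\<And>t. t \<in> {0..T} \<Longrightarrow> quadratic_interpolant \<Omega> (\<T>h t) (f t) (fh t)"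
    and U_in: "\<And>t. t \<in> {0<..T} \<Longrightarrow> U t \<in> Uh t"
    and P_in: "\<And>t. t \<in> {0<..T} \<Longrightarrow> P t \<in> mean_zero \<Omega> (Ph t)"
    and X_in: "\<And>t. t \<in> {0<..T} \<Longrightarrow> X t \<in> V_space (S t)"
    and X_id: "\<And>t x. t \<in> {0<..T} \<Longrightarrow> x \<in> surface (S t) \<Longrightarrow> X t x = x"
    and Xt_in: "\<And>t. t \<in> {0<..T} \<Longrightarrow> Xt t \<in> V_space (S t)"
    and Xt_nodal: "\<And>t k. t \<in> {0<..T} \<Longrightarrow> k \<in> \<Union>C \<Longrightarrow>
          Xt t (q k t) = vector_derivative (q k) (at t within {0..T})"
    and kappa_in: "\<And>t. t \<in> {0<..T} \<Longrightarrow> \<kappa> t \<in> W_space (S t)"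
    and eq_a: "\<And>t \<xi>. t \<in> {0<..T} \<Longrightarrow> \<xi> \<in> Uh t \<Longrightarrow>
          2 * L2_inner \<Omega> (\<lambda>x. \<mu> t x *\<^sub>R strain \<Omega> (U t) x) (strain \<Omega> \<xi>)
          - L2_inner \<Omega> (P t) (weak_div \<Omega> \<xi>)
          - \<gamma> * surface_inner (S t) (\<lambda>x. \<kappa> t x *\<^sub>R \<nu> t x) \<xi>
          = L2_inner \<Omega> (fh t) \<xi>"
    and eq_b: "\<And>t \<phi>. t \<in> {0<..T} \<Longrightarrow> \<phi> \<in> mean_zero \<Omega> (Ph t) \<Longrightarrow>
          L2_inner \<Omega> (weak_div \<Omega> (U t)) \<phi> = 0"
    and eq_c: "\<And>t w. t \<in> {0<..T} \<Longrightarrow> w \<in> W_space (S t) \<Longrightarrow>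
          lumped_inner (S t) (Xt t) (\<lambda>x. w x *\<^sub>R \<nu> t x)
          - surface_inner (S t) (U t) (\<lambda>x. w x *\<^sub>R \<nu> t x) = 0"
    and eq_d: "\<And>t \<eta>. t \<in> {0<..T} \<Longrightarrow> \<eta> \<in> V_space (S t) \<Longrightarrow>
          lumped_inner (S t) (\<lambda>x. \<kappa> t x *\<^sub>R \<nu> t x) \<eta>
          + surface_inner (S t) (surface_grad_vec (S t) (X t)) (surface_grad_vec (S t) \<eta>) = 0"
  shows "\<forall>t\<in>{0<..T}. \<exists>D.
          ((\<lambda>s. surface_area (surface (S s))) has_real_derivative D) (at t within {0..T}) \<and>
          \<gamma> * D + 2 * (L2_nrm \<Omega> (\<lambda>x. sqrt (\<mu> t x) *\<^sub>R strain \<Omega> (U t) x))\<^sup>2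
          = L2_inner \<Omega> (fh t) (U t)"
proof
  fix t assume t: "t \<in> {0<..T}"
  then have t': "t \<in> {0..T}" by simp
  define D where "D = surface_inner (S t) (surface_grad_vec (S t) (X t)) (surface_grad_vec (S t) (Xt t))"
  have "((\<lambda>s. surface_area (surface (S s))) has_real_derivative D) (at t within {0..T})"
    unfolding D_def by (rule surface_area_derivative[OF dim surf t' X_id[OF t] Xt_in[OF t] Xt_nodal[OF t]])
  moreover have "\<gamma> * D + 2 * (L2_nrm \<Omega> (\<lambda>x. sqrt (\<mu> t x) *\<^sub>R strain \<Omega> (U t) x))\<^sup>2 = L2_inner \<Omega> (fh t) (U t)"
  proof -
    have "L2_inner \<Omega> (P t) (weak_div \<Omega> (U t)) = 0"
      using eq_b[OF t P_in[OF t]] by (simp add: L2_inner_commute)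
    \<comment> \<open>The kinematic condition and the curvature equation use the same lumped
      product, and with these test functions the two lumped terms agree by symmetry. Eliminating
      them links the exactly integrated term with \<open>U t\<close> to \<open>D\<close>.\<close>
    moreover have "surface_inner (S t) (\<lambda>x. \<kappa> t x *\<^sub>R \<nu> t x) (U t) = - D"
      using eq_c[OF t kappa_in[OF t]] eq_d[OF t Xt_in[OF t]]
      by (simp add: D_def lumped_inner_commute[of _ _ "Xt t"] surface_inner_commute[of _ _ "U t"])
    moreover have "\<mu> t x \<ge> 0" for x
      using visc[OF t'] pos by (simp add: bulk_viscosity_def)
    ultimately show ?thesis
      using eq_a[OF t U_in[OF t]] by (simp add: L2_nrm_sqrt_weight)
  qed
  ultimately show "\<exists>D. ((\<lambda>s. surface_area (surface (S s))) has_real_derivative D) (at t within {0..T}) \<and>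
      \<gamma> * D + 2 * (L2_nrm \<Omega> (\<lambda>x. sqrt (\<mu> t x) *\<^sub>R strain \<Omega> (U t) x))\<^sup>2 = L2_inner \<Omega> (fh t) (U t)"
    by blast
qed

end
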